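(* Let $\mathcal{T}_0$ be a finite tree with $|\mathcal{T}_0|\ge 2$ vertices and Wiener index $\mathcal{W}_0$, and let $(\mathcal{T}_t)_{t\ge0}$ be the tree sequence generated from $\mathcal{T}_0$ by Algorithm-I. Then for every $t\ge 0$ the mean hitting time $\langle\mathcal{H}_t\rangle$ of the simple random walk on $\mathcal{T}_t$ is $$\langle\mathcal{H}_{t}\rangle=\frac{2}{5^{t}(|\mathcal{T}_{0}|-1)+1}\left\{75^{t}\,\mathcal{W}_{0}-4\cdot 5^{t}\left[\frac{15^{t}-5^{t}}{10}(|\mathcal{T}_{0}|-1)^{2}+\frac{15^{t}-1}{14}(|\mathcal{T}_{0}|-1)\right]\right\}.$$
   Context: Algorithm-I: given a finite tree $\mathcal{T}_{t-1}$ ($t\ge1$), with $k_v(t-1)$ denoting the degree of vertex $v$ in $\mathcal{T}_{t-1}$, the tree $\mathcal{T}_t$ is obtained by performing two operations: (i) for each vertex $v$ of $\mathcal{T}_{t-1}$ and each edge of $\mathcal{T}_{t-1}$ incident with $v$, insert one new vertex into that edge, next to $v$; thus every edge $uv$ of $\mathcal{T}_{t-1}$ receives two new vertices and is replaced by a path $u,u',v',v$ of length $3$; (ii) for each vertex $v$ of $\mathcal{T}_{t-1}$, attach $k_v(t-1)$ new vertices as leaves to $v$. $|\mathcal{T}|$ denotes the number of vertices of a tree $\mathcal{T}$. The Wiener index of a tree is $\mathcal{W}_{\mathcal{T}}=\frac12\sum_{u,v\in\mathcal{T}}d_{uv}$ (sum over ordered pairs), with $d_{uv}$ the graph distance; $\mathcal{W}_0=\mathcal{W}_{\mathcal{T}_0}$.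 The simple random walk moves from its current vertex $u$ to each neighbor with probability $1/\deg(u)$; the hitting time $\mathcal{H}_{u\to v}$ is the expected number of steps for the walk started at $u$ to first reach $v$ (with $\mathcal{H}_{u\to u}=0$). The mean hitting time of a graph with vertex set $\mathcal{V}$ is $\frac{1}{|\mathcal{V}|(|\mathcal{V}|-1)}\sum_{u,v\in\mathcal{V}}\mathcal{H}_{u\to v}$ (sum over ordered pairs); $\langle\mathcal{H}_t\rangle$ is this quantity for $\mathcal{T}_t$. *)

theory Defs
  imports
    "HOL-Probability.Probability"
    "Graph_Theory.Graph_Theory"
begin

text \<open>
  An undirected simple graph is a \<^locale>\<open>pair_graph\<close>: finite, loop-free, and
  with every edge \<open>uv\<close> represented by both arcs \<open>(u, v)\<close> and \<open>(v, u)\<close>.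
  The constant \<^const>\<open>tree\<close> of the library is meant for directed arcs: it also forbids the
  cycles \<open>u, v, u\<close> of length 2, which every symmetric digraph with an arc has.
  A cycle of an undirected simple graph is a \<^const>\<open>pre_digraph.cycle\<close> of length at least 3.
\<close>

definition undirected_tree :: "'a pair_pre_digraph \<Rightarrow> bool" where
  "undirected_tree G \<longleftrightarrow>
     pair_graph G \<and> connected (with_proj G) \<and>
     \<not> (\<exists>p. pre_digraph.cycle (with_proj G) p \<and> length p \<ge> 3)"

abbreviation degree :: "'a pair_pre_digraph \<Rightarrow> 'a \<Rightarrow> nat" where
  "degree G v \<equiv> out_degree (with_proj G) v"

text \<open>The library's distance is \<open>\<infinity>\<close> between different components; this does not occur in a
  connected graph, so there the conversion to a real number loses nothing.\<close>

definition graph_dist :: "'a pair_pre_digraph \<Rightarrow> 'a \<Rightarrow> 'a \<Rightarrow> real" where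
  "graph_dist G u v = real_of_ereal (wf_digraph.\<mu> (with_proj G) (\<lambda>_. 1) u v)"

definition wiener_index :: "'a pair_pre_digraph \<Rightarrow> real" where
  "wiener_index G = 1 / 2 * (\<Sum>u\<in>pverts G. \<Sum>v\<in>pverts G. graph_dist G u v)"


section \<open>The tree sequence\<close>

text \<open>
  The vertices of all trees of the sequence live in one type. If \<open>v\<close> is a vertex of the
  previous tree, \<open>Old v\<close> is the same vertex in the next tree, \<open>Inserted v w\<close> is the vertex inserted
  next to \<open>v\<close> into the edge \<open>vw\<close>, and \<open>Leaf v i\<close> is the \<open>i\<close>-th leaf attached to \<open>v\<close>,
  where \<open>i\<close> ranges over the numbers below the degree of \<open>v\<close>. The vertices of the initial tree are \<open>Initial x\<close>.
\<close>

datatype 'a vertex =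
    Initial 'a
  | Old "'a vertex"
  | Inserted "'a vertex" "'a vertex"
  | Leaf "'a vertex" nat

definition algorithm_I_step :: "'a vertex pair_pre_digraph \<Rightarrow> 'a vertex pair_pre_digraph" where
  "algorithm_I_step G =
     \<lparr> pverts = Old ` pverts G
         \<union> {Inserted v w | v w. (v, w) \<in> parcs G}
         \<union> {Leaf v i | v i. v \<in> pverts G \<and> i < degree G v},
       parcs = {(Inserted v w, Inserted w v) | v w. (v, w) \<in> parcs G}
         \<union> {(Old v, Inserted v w) | v w. (v, w) \<in> parcs G}
         \<union> {(Inserted v w, Old v) | v w. (v, w) \<in> parcs G}
         \<union> {(Old v, Leaf v i) | v i. v \<in> pverts G \<and> i < degree G v}
         \<union> {(Leaf v i, Old v) | v i. v \<in> pverts G \<and> i < degree G v} \<rparr>"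

primrec algorithm_I :: "'a pair_pre_digraph \<Rightarrow> nat \<Rightarrow> 'a vertex pair_pre_digraph" where
  "algorithm_I G 0 =
     \<lparr> pverts = Initial ` pverts G, parcs = map_prod Initial Initial ` parcs G \<rparr>"
| "algorithm_I G (Suc t) = algorithm_I_step (algorithm_I G t)"


section \<open>Simple random walk and hitting times\<close>

text \<open>Distribution of the \<open>n\<close>-th position of the walk started at \<open>u\<close>, given the earlier
  positions \<open>\<omega> 0, \<dots>, \<omega> (n - 1)\<close>.\<close>

definition srw_kernel ::
  "'a pair_pre_digraph \<Rightarrow> 'a \<Rightarrow> nat \<Rightarrow> (nat \<Rightarrow> 'a) \<Rightarrow> 'a measure" where
  "srw_kernel G u n \<omega> = measure_pmf
     (case n of
        0 \<Rightarrow> return_pmf u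
      | Suc m \<Rightarrow> pmf_of_set {y. (\<omega> m, y) \<in> parcs G})"

lemma Ionescu_Tulcea_srw_kernel:
  fixes G :: "'a pair_pre_digraph"
  shows "Ionescu_Tulcea (srw_kernel G u) (\<lambda>_. count_space UNIV)"
proof (rule Ionescu_Tulcea.intro)
  fix n
  let ?M = "\<lambda>_::nat. count_space (UNIV :: 'a set)"
  show "srw_kernel G u n \<in> measurable (PiM {0..<n} ?M) (subprob_algebra (count_space UNIV))"
  proof (cases n)
    case 0
    then show ?thesis
      by (simp add: srw_kernel_def[abs_def] space_subprob_algebra measure_pmf.subprob_space_axioms)
  next
    case (Suc m)
    have "(\<lambda>x. measure_pmf (pmf_of_set {y. (x, y) \<in> parcs G}))
        \<in> measurable (count_space UNIV) (subprob_algebra (count_space UNIV))"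
      by (simp add: space_subprob_algebra measure_pmf.subprob_space_axioms)
    moreover have "(\<lambda>\<omega>. \<omega> m) \<in> measurable (PiM {0..<n} ?M) (count_space UNIV)"
      using Suc by (intro measurable_component_singleton) auto
    ultimately show ?thesis
      using Suc by (auto simp: srw_kernel_def[abs_def] intro: measurable_compose)
  qed
next
  fix n and x :: "nat \<Rightarrow> 'a"
  show "prob_space (srw_kernel G u n x)"
    by (simp add: srw_kernel_def measure_pmf.prob_space_axioms)
qed

text \<open>The law of the trajectory of the walk.\<close>

definition srw :: "'a pair_pre_digraph \<Rightarrow> 'a \<Rightarrow> (nat \<Rightarrow> 'a) measure" where
  "srw G u = projective_family.lim UNIV
     (Ionescu_Tulcea.CI (srw_kernel G u) (\<lambda>_. count_space UNIV)) (\<lambda>_. count_space UNIV)"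

text \<open>The infimum is \<open>\<infinity>\<close> on trajectories that never visit \<open>v\<close>.\<close>

definition hitting_time :: "'a pair_pre_digraph \<Rightarrow> 'a \<Rightarrow> 'a \<Rightarrow> ennreal" where
  "hitting_time G u v = (\<integral>\<^sup>+ \<omega>. (INF n\<in>{n. \<omega> n = v}. of_nat n) \<partial>srw G u)"

definition mean_hitting_time :: "'a pair_pre_digraph \<Rightarrow> ennreal" where
  "mean_hitting_time G =
     (\<Sum>u\<in>pverts G. \<Sum>v\<in>pverts G. hitting_time G u v)
       / of_nat (card (pverts G) * (card (pverts G) - 1))"

end

theory Submission
  imports Defs
begin

text \<open>
  In a tree, every vertex \<open>u \<noteq> v\<close> has exactly one neighbour closer to \<open>v\<close> than \<open>u\<close>, and all its other
  neighbours are farther from \<open>v\<close> by one. All that is needed about distances follows from this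
  local rule. Summing a function of the distance to \<open>v\<close> over the
  neighbours of every vertex, and exchanging the two ends of each arc, gives the number of edges and the
  degree-weighted distance sums. The rule also makes
  \<open>1/2 * \<Sum>w. deg w * (d u v + d v w - d u w)\<close> satisfy the first-step equations of the hitting time of \<open>v\<close>,
  and nonnegative bounded solutions of these equations are unique because their expectation along
  the walk killed at \<open>v\<close> decreases in each step by the survival probability. Hence the mean hitting time is twice the
  Wiener index over the number of vertices.

  One step of the algorithm replaces each vertex by a cluster of itself, its inserted
  neighbours and its leaves. A distance in the new tree is three times the distance of the clusters
  plus a correction from each end, which satisfies the local rule again; summation gives
  \<open>W' = 75 * W - 20 * e\<^sup>2 - 20 * e\<close> and \<open>e' = 5 * e\<close> for the Wiener index and the number \<open>e\<close> of edges.
\<close>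

section \<open>Trees through their distance function\<close>

lemma degree_eq_card: "degree G v = card {w. (v, w) \<in> parcs G}"
proof -
  have "out_arcs (with_proj G) v = Pair v ` {w. (v, w) \<in> parcs G}"
    by (auto simp: out_arcs_def)
  then show ?thesis
    by (simp add: out_degree_def card_image inj_on_def)
qed

text \<open>The distance is an integer-valued function subject only to the local rule, so that an
  explicit formula for the new tree can be certified without constructing walks. Integers make
  \<open>d u v - 1\<close> a genuine subtraction.\<close>

locale tree_metric =
  fixes G :: "'a pair_pre_digraph" and d :: "'a \<Rightarrow> 'a \<Rightarrow> int"
  assumes finite_verts: "finite (pverts G)"
    and arc_in_verts: "(u, v) \<in> parcs G \<Longrightarrow> u \<in> pverts G \<and> v \<in> pverts G"
    and arc_sym: "(u, v) \<in> parcs G \<Longrightarrow> (v, u) \<in> parcs G"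
    and arc_irrefl: "(u, u) \<notin> parcs G"
    and d_self: "u \<in> pverts G \<Longrightarrow> d u u = 0"
    and d_sym: "u \<in> pverts G \<Longrightarrow> v \<in> pverts G \<Longrightarrow> d u v = d v u"
    and d_pos: "u \<in> pverts G \<Longrightarrow> v \<in> pverts G \<Longrightarrow> u \<noteq> v \<Longrightarrow> 1 \<le> d u v"
    and closer: "u \<in> pverts G \<Longrightarrow> v \<in> pverts G \<Longrightarrow> u \<noteq> v \<Longrightarrow>
      \<exists>w. (u, w) \<in> parcs G \<and> d w v = d u v - 1 \<and>
        (\<forall>z. (u, z) \<in> parcs G \<longrightarrow> z \<noteq> w \<longrightarrow> d z v = d u v + 1)"
begin

section \<open>Neighbours and distances along an arc\<close>

definition nbrs :: "'a \<Rightarrow> 'a set" where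
  "nbrs u = {w. (u, w) \<in> parcs G}"

definition deg :: "'a \<Rightarrow> int" where
  "deg u = int (card (nbrs u))"

lemma mem_nbrs [simp]: "w \<in> nbrs u \<longleftrightarrow> (u, w) \<in> parcs G"
  by (simp add: nbrs_def)

lemma nbrs_subset: "nbrs u \<subseteq> pverts G"
  using arc_in_verts by auto

lemma finite_nbrs [simp]: "finite (nbrs u)"
  using finite_subset[OF nbrs_subset finite_verts] .

lemma finite_arcs: "finite (parcs G)"
  by (rule finite_subset[of _ "pverts G \<times> pverts G"]) (use finite_verts arc_in_verts in auto)

lemma of_nat_degree: "int (degree G u) = deg u"
  by (simp add: degree_eq_card deg_def nbrs_def)

lemma d_nonneg: "u \<in> pverts G \<Longrightarrow> v \<in> pverts G \<Longrightarrow> 0 \<le> d u v"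
  using d_pos[of u v] d_self[of u] by (cases "u = v") auto

lemma d_arc: 
  assumes "(u, w) \<in> parcs G"
  shows "d u w = 1"
proof -
  have uw: "u \<in> pverts G" "w \<in> pverts G" "u \<noteq> w"
    using assms arc_in_verts arc_irrefl by auto
  obtain x where x: "(u, x) \<in> parcs G" "d x w = d u w - 1"
      "\<And>z. (u, z) \<in> parcs G \<Longrightarrow> z \<noteq> x \<Longrightarrow> d z w = d u w + 1"
    using closer[OF uw] by blast
  \<comment> \<open>Otherwise \<open>w\<close> would be at positive distance from itself.\<close>
  have "w = x"
    using x(3)[OF assms] uw d_self d_pos[OF uw] by auto
  then show ?thesis
    using x(2) uw d_self by auto
qed

lemma d_nbr_cases:
  assumes "(u, w) \<in> parcs G" "v \<in> pverts G"
  shows "d w v = d u v + 1 \<or> d w v = d u v - 1"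
proof (cases "u = v")
  case True
  then show ?thesis
    using d_arc[OF arc_sym[OF assms(1)]] d_self[OF assms(2)] by simp
next
  case False
  then show ?thesis
    using closer[of u v] assms arc_in_verts by metis
qed

lemma d_nbr_cases':
  assumes "(u, w) \<in> parcs G" "v \<in> pverts G"
  shows "d v w = d v u + 1 \<or> d v w = d v u - 1"
  using d_nbr_cases[OF assms] d_sym assms(2) arc_in_verts[OF assms(1)] by metis

lemma closer_unique:
  assumes "(u, w) \<in> parcs G" "(u, w') \<in> parcs G" "v \<in> pverts G"
    and "d w v = d u v - 1" "d w' v = d u v - 1"
  shows "w = w'"
proof -
  have u: "u \<in> pverts G" using assms arc_in_verts by blast
  have "u \<noteq> v"
    using assms d_self[OF u] d_nonneg[of w v] arc_in_verts by fastforce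
  then obtain x where x: "\<And>z. (u, z) \<in> parcs G \<Longrightarrow> z \<noteq> x \<Longrightarrow> d z v = d u v + 1"
    using closer[OF u assms(3)] by blast
  have "w = x" "w' = x"
    using x[OF assms(1)] x[OF assms(2)] assms(4,5) by auto
  then show ?thesis by simp
qed

section \<open>Sums over neighbourhoods and degree-weighted sums\<close>

lemma sum_nbrs:
  fixes f :: "int \<Rightarrow> int"
  assumes u: "u \<in> pverts G" and v: "v \<in> pverts G" and "u \<noteq> v"
  shows "(\<Sum>w\<in>nbrs u. f (d w v)) = (deg u - 1) * f (d u v + 1) + f (d u v - 1)"
proof -
  obtain x where x: "x \<in> nbrs u" "d x v = d u v - 1"
      "\<And>z. z \<in> nbrs u \<Longrightarrow> z \<noteq> x \<Longrightarrow> d z v = d u v + 1"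
    using closer[OF assms] by auto
  have "card (nbrs u) \<noteq> 0"
    using x(1) by auto
  then have deg: "int (card (nbrs u - {x})) = deg u - 1"
    using x(1) by (simp add: deg_def of_nat_diff Suc_le_eq card_gt_0_iff)
  have "(\<Sum>w\<in>nbrs u. f (d w v)) = f (d x v) + (\<Sum>w\<in>nbrs u - {x}. f (d w v))"
    using x(1) by (simp add: sum.remove)
  also have "(\<Sum>w\<in>nbrs u - {x}. f (d w v)) = (\<Sum>w\<in>nbrs u - {x}. f (d u v + 1))"
    using x(3) by (intro sum.cong) auto
  finally show ?thesis
    using deg x(2) by simp
qed

lemma sum_nbrs_self:
  fixes f :: "int \<Rightarrow> int"
  shows "(\<Sum>w\<in>nbrs v. f (d w v)) = deg v * f 1"
proof -
  have "(\<Sum>w\<in>nbrs v. f (d w v)) = (\<Sum>w\<in>nbrs v. f 1)"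
    by (intro sum.cong) (auto simp: d_arc[OF arc_sym])
  then show ?thesis
    by (simp add: deg_def)
qed

lemma sum_nbrs_d:
  assumes "u \<in> pverts G" "v \<in> pverts G"
  shows "(\<Sum>w\<in>nbrs u. d w v) = deg u * d u v + deg u - 2 + (if u = v then 2 else 0)"
  using sum_nbrs[OF assms, of "\<lambda>x. x"] sum_nbrs_self[of "\<lambda>x. x" v] d_self[OF assms(2)]
  by (auto simp: algebra_simps)

lemma sum_nbrs_swap:
  fixes f :: "'a \<Rightarrow> int"
  shows "(\<Sum>u\<in>pverts G. \<Sum>w\<in>nbrs u. f w) = (\<Sum>w\<in>pverts G. deg w * f w)"
proof -
  have nb: "nbrs u = {w \<in> pverts G. (u, w) \<in> parcs G}"
       "nbrs u = {w \<in> pverts G. (w, u) \<in> parcs G}" for u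
    using arc_in_verts arc_sym by auto
  have "(\<Sum>u\<in>pverts G. \<Sum>w\<in>nbrs u. f w) = (\<Sum>w\<in>pverts G. \<Sum>u\<in>nbrs w. f w)"
    by (subst nb(1), subst nb(2), rule sum.swap_restrict) (use finite_verts in auto)
  then show ?thesis
    by (simp add: deg_def)
qed

text \<open>A tree has one edge less than vertices. Exchanging the ends of arcs in the sum of
  distances to \<open>v\<close> yields the same degree-weighted sum on both sides, so the surplus,
  the sum of all \<open>deg u - 2\<close> plus 2, vanishes.\<close>

lemma sum_deg:
  assumes "pverts G \<noteq> {}"
  shows "(\<Sum>u\<in>pverts G. deg u) = 2 * (int (card (pverts G)) - 1)"
proof -
  obtain v where v: "v \<in> pverts G" using assms by blast
  have "(\<Sum>u\<in>pverts G. deg u * d u v) = (\<Sum>u\<in>pverts G. \<Sum>w\<in>nbrs u. d w v)"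
    by (rule sum_nbrs_swap[symmetric])
  also have "\<dots> = (\<Sum>u\<in>pverts G. deg u * d u v + deg u - 2 + (if u = v then 2 else 0))"
    using sum_nbrs_d[OF _ v] by (intro sum.cong) auto
  also have "\<dots> = (\<Sum>u\<in>pverts G. deg u * d u v) + (\<Sum>u\<in>pverts G. deg u)
      - 2 * int (card (pverts G)) + 2"
    using v finite_verts by (simp add: sum.distrib sum_subtractf)
  finally show ?thesis
    by simp
qed

text \<open>Obtained by exchanging the ends of the arcs in the sum of the squared distances to \<open>v\<close>.\<close>

lemma sum_deg_d:
  assumes v: "v \<in> pverts G"
  shows "(\<Sum>u\<in>pverts G. deg u * d u v) =
    2 * (\<Sum>u\<in>pverts G. d u v) - (int (card (pverts G)) - 1)"
proof -
  \<comment> \<open>The formula needs no extra case for \<open>u = v\<close>: the term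
    \<open>4 * d u v\<close> is then zero.\<close>
  have sq: "(\<Sum>w\<in>nbrs u. (d w v)\<^sup>2) = deg u * (d u v)\<^sup>2 + deg u * (2 * d u v + 1) - 4 * d u v"
    if "u \<in> pverts G" for u
    using sum_nbrs[OF that v, of "\<lambda>x. x\<^sup>2"] sum_nbrs_self[of "\<lambda>x. x\<^sup>2" v] d_self[OF v]
    by (cases "u = v") (auto simp: algebra_simps power2_eq_square)
  have "(\<Sum>u\<in>pverts G. deg u * (d u v)\<^sup>2) = (\<Sum>u\<in>pverts G. \<Sum>w\<in>nbrs u. (d w v)\<^sup>2)"
    by (rule sum_nbrs_swap[symmetric])
  also have "\<dots> = (\<Sum>u\<in>pverts G. deg u * (d u v)\<^sup>2 + 2 * (deg u * d u v) + deg u - 4 * d u v)"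
    using sq by (intro sum.cong) (auto simp: algebra_simps)
  also have "\<dots> = (\<Sum>u\<in>pverts G. deg u * (d u v)\<^sup>2) + 2 * (\<Sum>u\<in>pverts G. deg u * d u v)
      + (\<Sum>u\<in>pverts G. deg u) - 4 * (\<Sum>u\<in>pverts G. d u v)"
    by (simp add: sum.distrib sum_subtractf sum_distrib_left)
  finally show ?thesis
    using sum_deg v by (cases "pverts G = {}") auto
qed

section \<open>The explicit formula for hitting times\<close>

lemma d_triangle:
  assumes "u \<in> pverts G" "v \<in> pverts G" "w \<in> pverts G"
  shows "d u w \<le> d u v + d v w"
  using assms(1)
proof (induction "nat (d u v)" arbitrary: u)
  case 0
  then have "u = v"
    using d_pos[of u v] assms by force
  then show ?case
    using d_self assms by simp
next
  case (Suc n)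
  then have "u \<noteq> v" using d_self assms by force
  then obtain x where x: "(u, x) \<in> parcs G" "d x v = d u v - 1"
    using closer[of u v] Suc assms by blast
  have "d x w \<le> d x v + d v w"
    using Suc x arc_in_verts by (intro Suc.hyps(1)) auto
  moreover have "d u w \<le> d x w + 1"
    using d_nbr_cases[OF x(1) assms(3)] by auto
  ultimately show ?case
    using x(2) by simp
qed

text \<open>Half of \<open>d u v + d v w - d u w\<close> is the length of the common part of the
  paths from \<open>u\<close> and from \<open>w\<close> to \<open>v\<close>. Weighting it by
  \<open>deg w\<close> gives the hitting time of \<open>v\<close> from \<open>u\<close>; doubling
  keeps the values integral.\<close>

definition twice_hitting :: "'a \<Rightarrow> 'a \<Rightarrow> int" where
  "twice_hitting u v = (\<Sum>w\<in>pverts G. deg w * (d u v + d v w - d u w))"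

lemma deg_nonneg: "0 \<le> deg u"
  by (simp add: deg_def)

lemma twice_hitting_nonneg: "u \<in> pverts G \<Longrightarrow> v \<in> pverts G \<Longrightarrow> 0 \<le> twice_hitting u v"
  unfolding twice_hitting_def using d_triangle[of u v] deg_nonneg by (intro sum_nonneg mult_nonneg_nonneg) auto

lemma twice_hitting_self: "v \<in> pverts G \<Longrightarrow> twice_hitting v v = 0"
  by (simp add: twice_hitting_def d_self)

text \<open>The first-step equation multiplied by \<open>2 * deg u\<close>. The terms
  \<open>deg u - 2\<close> of the neighbour sums for the targets \<open>v\<close> and
  \<open>w\<close> cancel; only the exceptional summand at \<open>w = u\<close> survives and
  contributes \<open>- 2 * deg u\<close>.\<close>

lemma sum_nbrs_twice_hitting:
  assumes "u \<in> pverts G" "v \<in> pverts G" "u \<noteq> v"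
  shows "(\<Sum>z\<in>nbrs u. twice_hitting z v) = deg u * (twice_hitting u v - 2)"
proof -
  have "(\<Sum>z\<in>nbrs u. twice_hitting z v) =
      (\<Sum>w\<in>pverts G. \<Sum>z\<in>nbrs u. deg w * (d z v + d v w - d z w))"
    unfolding twice_hitting_def by (rule sum.swap)
  also have "\<dots> = (\<Sum>w\<in>pverts G. deg w * ((\<Sum>z\<in>nbrs u. d z v) + deg u * d v w - (\<Sum>z\<in>nbrs u. d z w)))"
    by (simp add: sum_distrib_left sum.distrib sum_subtractf deg_def algebra_simps)
  also have "\<dots> = (\<Sum>w\<in>pverts G. deg u * (deg w * (d u v + d v w - d u w))
       - (if w = u then 2 * deg u else 0))"
    using assms by (intro sum.cong refl) (auto simp: sum_nbrs_d algebra_simps)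
  also have "\<dots> = deg u * (twice_hitting u v - 2)"
    using assms finite_verts by (simp add: sum_subtractf twice_hitting_def sum_distrib_left right_diff_distrib mult.commute[of _ 2])
  finally show ?thesis .
qed

text \<open>Over all ordered pairs the terms with \<open>d v w\<close> and \<open>d u w\<close>
  cancel, leaving the total degree times the sum of distances.\<close>

lemma sum_twice_hitting:
  assumes "pverts G \<noteq> {}"
  shows "(\<Sum>u\<in>pverts G. \<Sum>v\<in>pverts G. twice_hitting u v) =
    2 * (int (card (pverts G)) - 1) * (\<Sum>u\<in>pverts G. \<Sum>v\<in>pverts G. d u v)"
proof -
  define S where "S = (\<Sum>u\<in>pverts G. \<Sum>v\<in>pverts G. d u v)"
  have 1: "(\<Sum>u\<in>pverts G. \<Sum>v\<in>pverts G. \<Sum>w\<in>pverts G. deg w * d u v) = (\<Sum>w\<in>pverts G. deg w) * S"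
    unfolding S_def sum_distrib_left sum_distrib_right by (subst sum.swap, subst sum.swap) (rule refl)
  have 2: "(\<Sum>u\<in>pverts G. \<Sum>v\<in>pverts G. \<Sum>w\<in>pverts G. deg w * d v w) =
           (\<Sum>u\<in>pverts G. \<Sum>v\<in>pverts G. \<Sum>w\<in>pverts G. deg w * d u w)"
    by (rule sum.swap)
  have "(\<Sum>u\<in>pverts G. \<Sum>v\<in>pverts G. twice_hitting u v) = (\<Sum>w\<in>pverts G. deg w) * S"
    using 1 2 by (simp add: twice_hitting_def algebra_simps sum.distrib sum_subtractf)
  then show ?thesis
    using sum_deg[OF assms] by (simp add: S_def)
qed

end

section \<open>The distance function of an undirected tree\<close>

context pair_graph
begin

text \<open>A natural number attained by a walk, hence open to induction, unlike the extended-real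
  infimum in \<open>graph_dist\<close>.\<close>

definition hops :: "'a \<Rightarrow> 'a \<Rightarrow> nat" where
  "hops u v = (LEAST n. \<exists>p. awalk u p v \<and> length p = n)"

lemma hops_le: "awalk u p v \<Longrightarrow> hops u v \<le> length p"
  unfolding hops_def by (rule Least_le) blast

lemma shortest_awalk:
  assumes "awalk u q v"
  obtains p where "awalk u p v" "length p = hops u v"
proof -
  have "\<exists>n p. awalk u p v \<and> length p = n"
    using assms by blast
  then have "\<exists>p. awalk u p v \<and> length p = hops u v"
    unfolding hops_def by (rule LeastI_ex)
  then show ?thesis
    using that by blast
qed

lemma awalk_cost_1: "awalk_cost (\<lambda>_. 1) p = real (length p)"
  by (induction p) auto

lemma graph_dist_eq_hops:
  assumes "awalk u q v"
  shows "graph_dist G u v = real (hops u v)"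
proof -
  obtain p where p: "awalk u p v" "length p = hops u v"
    using shortest_awalk[OF assms] .
  have "\<mu> (\<lambda>_. 1) u v = ereal (real (hops u v))"
    unfolding \<mu>_def
  proof (rule antisym)
    show "(INF p\<in>{p. awalk u p v}. ereal (awalk_cost (\<lambda>_. 1) p)) \<le> ereal (real (hops u v))"
      using p by (intro INF_lower2[of p]) (auto simp: awalk_cost_1)
    show "ereal (real (hops u v)) \<le> (INF p\<in>{p. awalk u p v}. ereal (awalk_cost (\<lambda>_. 1) p))"
      by (intro INF_greatest) (auto simp: awalk_cost_1 hops_le)
  qed
  then show ?thesis
    by (simp add: graph_dist_def)
qed

lemma hops_self: "u \<in> pverts G \<Longrightarrow> hops u u = 0"
  using hops_le[of u "[]" u] by (simp add: awalk_Nil_iff)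

lemma length_rev_path: "length (rev_path p) = length p"
  by (induction p) auto

lemma pawalk_verts_snoc:
  "pcas u p b \<Longrightarrow> pawalk_verts u (p @ [(b, c)]) = pawalk_verts u p @ [c]"
  by (induction p arbitrary: u) auto

end

locale connected_pair_graph = pair_graph +
  assumes awalk_ex: "u \<in> pverts G \<Longrightarrow> v \<in> pverts G \<Longrightarrow> \<exists>p. awalk u p v"
begin

lemma hops_walk:
  assumes "u \<in> pverts G" "v \<in> pverts G"
  obtains p where "awalk u p v" "length p = hops u v"
  using awalk_ex[OF assms] shortest_awalk by blast

lemma hops_eq_0:
  assumes "u \<in> pverts G" "v \<in> pverts G" "hops u v = 0"
  shows "u = v"
  using hops_walk[OF assms(1,2)] assms(3) by (metis awalk_Nil_iff length_0_conv)

lemma hops_sym_le: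
  assumes "u \<in> pverts G" "v \<in> pverts G"
  shows "hops u v \<le> hops v u"
proof -
  obtain p where "awalk v p u" "length p = hops v u"
    using hops_walk[OF assms(2,1)] .
  then show ?thesis
    using hops_le[of u "rev_path p" v] by (simp add: length_rev_path)
qed

lemma hops_arc:
  assumes "(u, w) \<in> parcs G" "v \<in> pverts G"
  shows "hops u v \<le> hops w v + 1"
proof -
  obtain p where "awalk w p v" "length p = hops w v"
    using hops_walk[OF in_arcsD2[OF assms(1)] assms(2)] .
  then show ?thesis
    using hops_le[of u "(u, w) # p" v] assms by (simp add: awalk_Cons_iff)
qed

lemma hops_closer:
  assumes "u \<in> pverts G" "v \<in> pverts G" "u \<noteq> v"
  obtains w where "(u, w) \<in> parcs G" "hops u v = hops w v + 1"
proof -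
  obtain p where p: "awalk u p v" "length p = hops u v"
    using hops_walk[OF assms(1,2)] .
  obtain e es where "p = e # es"
    using p(1) assms(3) by (cases p) (auto simp: awalk_Nil_iff)
  then have arc: "(u, snd e) \<in> parcs G" "awalk (snd e) es v"
    using p(1) by (auto simp: awalk_Cons_iff)
  then have "hops u v = hops (snd e) v + 1"
    using hops_le[OF arc(2)] hops_arc[OF arc(1) assms(2)] p(2) \<open>p = e # es\<close> by simp
  then show ?thesis
    using that arc(1) by blast
qed

text \<open>The induction closes a cycle: a path staying at distance at least \<open>n\<close> from \<open>v\<close> whose ends are
  at distance \<open>n\<close> is extended at both ends towards \<open>v\<close> until the two ends meet, at the latest in \<open>v\<close>.\<close>

lemma no_upper_path:
  assumes acyclic: "\<not> (\<exists>p. cycle p \<and> length p \<ge> 3)" and v: "v \<in> pverts G"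
    and "apath a p b" "p \<noteq> []" "hops a v = n" "hops b v = n"
    and "\<forall>x\<in>set (awalk_verts a p). n \<le> hops x v"
  shows False
  using assms(3-)
proof (induction n arbitrary: a b p)
  case 0
  have "a \<in> pverts G" "b \<in> pverts G"
    using 0(1) awalk_hd_in_verts awalk_last_in_verts by (auto simp: apath_def)
  then have "a = v" "b = v"
    using hops_eq_0 v 0 by auto
  then show False
    using apath_nonempty_ends[OF 0(1,2)] by simp
next
  case (Suc m)
  have walk: "awalk a p b" and dist: "distinct (awalk_verts a p)"
    using Suc.prems(1) by (auto simp: apath_def)
  have ab: "a \<in> pverts G" "b \<in> pverts G"
    using walk awalk_hd_in_verts awalk_last_in_verts by blast+
  have "a \<noteq> v" "b \<noteq> v"
    using Suc.prems hops_self[OF v] by auto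
  then obtain a' b' where a': "(a, a') \<in> parcs G" "hops a' v = m" and b': "(b, b') \<in> parcs G" "hops b' v = m"
    using hops_closer[OF ab(1) v] hops_closer[OF ab(2) v] Suc.prems(3,4) by (metis Suc_eq_plus1 nat.inject)
  \<comment> \<open>The path stays at distance at least \<open>Suc m\<close> from \<open>v\<close>,
    whereas the new vertices are at distance \<open>m\<close>.\<close>
  have notin: "a' \<notin> set (awalk_verts a p)" "b' \<notin> set (awalk_verts a p)"
    using Suc.prems(5) a'(2) b'(2) by fastforce+
  define q where "q = (a', a) # p @ [(b, b')]"
  have q: "awalk a' q b'"
    using walk a'(1) b'(1) arcs_symmetric by (auto simp: q_def awalk_Cons_iff awalk_append_iff awalk_Nil_iff dest: wellformed')
  have verts: "awalk_verts a' q = a' # awalk_verts a p @ [b']"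
    using walk pawalk_verts_snoc[of a p b b'] by (auto simp: q_def awalk_def)
  show False
  proof (cases "a' = b'")
    case True
    have "cycle q"
      unfolding cycle_def using q dist notin True verts by (intro exI[of _ a']) (auto simp: q_def)
    \<comment> \<open>Two arcs are added to a nonempty path, so the cycle is not one of the trivial
      cycles of length 2.\<close>
    moreover have "3 \<le> length q"
      using Suc.prems(2) by (cases p) (auto simp: q_def)
    ultimately show False
      using acyclic by blast
  next
    case False
    \<comment> \<open>The lengthened path satisfies the same conditions one level lower.\<close>
    then have "apath a' q b'"
      using q dist notin verts by (auto simp: apath_def)
    moreover have "\<forall>x\<in>set (awalk_verts a' q). m \<le> hops x v"
      using verts Suc.prems(5) a'(2) b'(2) by fastforce
    ultimately show False
      using Suc.IH[of a' q b'] a'(2) b'(2) by (simp add: q_def)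
  qed
qed

text \<open>The local rule can fail in two ways, and each gives a path excluded by
  \<open>no_upper_path\<close>: a neighbour \<open>z\<close> at the distance of \<open>u\<close>
  gives the path \<open>u, z\<close>, and a second closer neighbour \<open>z\<close> gives
  \<open>z, u, w\<close>.\<close>

lemma tree_metric_hops:
  assumes acyclic: "\<not> (\<exists>p. cycle p \<and> length p \<ge> 3)"
  shows "tree_metric G (\<lambda>u v. int (hops u v))"
proof
  show "finite (pverts G)" by (rule pair_finite_verts)
  show "u \<in> pverts G \<and> v \<in> pverts G" if "(u, v) \<in> parcs G" for u v
    using that wellformed' by blast
  show "(v, u) \<in> parcs G" if "(u, v) \<in> parcs G" for u v
    using that by (rule arcs_symmetric)
  show "(u, u) \<notin> parcs G" for u
    using no_loops' by blast
  show "int (hops u u) = 0" if "u \<in> pverts G" for u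
    using that hops_self by simp
  show "int (hops u v) = int (hops v u)" if "u \<in> pverts G" "v \<in> pverts G" for u v
    using hops_sym_le[OF that] hops_sym_le[OF that(2,1)] by simp
  show "1 \<le> int (hops u v)" if "u \<in> pverts G" "v \<in> pverts G" "u \<noteq> v" for u v
    using hops_eq_0[OF that(1,2)] that(3) by (cases "hops u v") auto
  show "\<exists>w. (u, w) \<in> parcs G \<and> int (hops w v) = int (hops u v) - 1 \<and>
      (\<forall>z. (u, z) \<in> parcs G \<longrightarrow> z \<noteq> w \<longrightarrow> int (hops z v) = int (hops u v) + 1)"
    if u: "u \<in> pverts G" and v: "v \<in> pverts G" and "u \<noteq> v" for u v
  proof -
    obtain w where w: "(u, w) \<in> parcs G" "hops u v = hops w v + 1"
      using hops_closer[OF u v \<open>u \<noteq> v\<close>] .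
    have "hops z v = hops u v + 1" if z: "(u, z) \<in> parcs G" "z \<noteq> w" for z
    proof -
      have zu: "(z, u) \<in> parcs G" "u \<noteq> z" "u \<noteq> w"
        using z(1) w(1) arcs_symmetric no_loops' by blast+
      have "hops z v \<noteq> hops u v"
      proof
        assume eq: "hops z v = hops u v"
        have "apath u [(u, z)] z"
          using z(1) zu in_arcsD2[OF z(1)] by (auto simp: apath_def awalk_simps)
        then show False
          by (rule no_upper_path[OF acyclic v, where n = "hops u v"]) (use eq in auto)
      qed
      moreover have "hops z v \<noteq> hops w v"
      proof
        assume eq: "hops z v = hops w v"
        have "apath z [(z, u), (u, w)] w"
          using z zu w(1) in_arcsD2[OF w(1)] by (auto simp: apath_def awalk_simps)
        then show False
          by (rule no_upper_path[OF acyclic v, where n = "hops w v"]) (use eq w in auto)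
      qed
      ultimately show ?thesis
        using hops_arc[OF z(1) v] hops_arc[OF zu(1) v] w(2) by linarith
    qed
    then show ?thesis
      using w by (intro exI[of _ w]) auto
  qed
qed

end

lemma undirected_tree_imp_tree_metric:
  assumes "undirected_tree G"
  obtains d where "tree_metric G d"
    and "\<And>u v. u \<in> pverts G \<Longrightarrow> v \<in> pverts G \<Longrightarrow> graph_dist G u v = real_of_int (d u v)"
proof -
  interpret pair_graph G
    using assms by (simp add: undirected_tree_def)
  have sc: "strongly_connected (with_proj G)"
    using symmetric_connected_imp_strongly_connected sym_arcs assms by (simp add: undirected_tree_def)
  interpret connected_pair_graph G
  proof
    show "\<exists>p. awalk u p v" if "u \<in> pverts G" "v \<in> pverts G" for u v
      using sc that unfolding strongly_connected_def by (simp add: reachable_awalk)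
  qed
  show ?thesis
  proof (rule that)
    show "tree_metric G (\<lambda>u v. int (hops u v))"
      using assms by (intro tree_metric_hops) (simp add: undirected_tree_def)
    show "graph_dist G u v = real_of_int (int (hops u v))" if "u \<in> pverts G" "v \<in> pverts G" for u v
      using awalk_ex[OF that] graph_dist_eq_hops by auto
  qed
qed

section \<open>One step of the algorithm\<close>

text \<open>Removing the edge \<open>uz\<close> splits the tree. A step from \<open>v\<close> to
  \<open>w\<close> that leaves \<open>u\<close> and approaches \<open>z\<close> must cross between
  the two sides, which only \<open>uz\<close> does.\<close>

lemma (in tree_metric) arcs_aligned:
  assumes "(u, z) \<in> parcs G" "(v, w) \<in> parcs G"
    and "d w u = d v u + 1" "d w z = d v z - 1"
  shows "u = v \<and> z = w"
proof -
  have V: "u \<in> pverts G" "z \<in> pverts G" "v \<in> pverts G" "w \<in> pverts G"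
    using assms arc_in_verts by auto
  have dz: "d w z = d v u" "d v z = d v u + 1"
    using d_nbr_cases'[OF assms(1) V(3)] d_nbr_cases'[OF assms(1) V(4)] assms(3,4) by arith+
  have "w = z"
  proof (rule ccontr)
    assume "w \<noteq> z"
    then obtain x where x: "(w, x) \<in> parcs G" "d x z = d w z - 1"
      using closer[OF V(4,2)] by blast
    have xV: "x \<in> pverts G"
      using x arc_in_verts by blast
    \<comment> \<open>The step from \<open>w\<close> towards \<open>z\<close> also approaches
      \<open>u\<close>, as does the step back to \<open>v\<close>. The closer neighbour is unique,
      so \<open>x = v\<close>, but \<open>v\<close> is farther from \<open>z\<close>.\<close>
    have "d x u = d w u - 1"
      using d_nbr_cases'[OF assms(1) xV] d_nbr_cases[OF x(1) V(1)] x(2) dz(1) assms(3) by arith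
    moreover have "d v u = d w u - 1"
      using assms(3) by linarith
    ultimately have "x = v"
      by (rule closer_unique[OF x(1) arc_sym[OF assms(2)] V(1)])
    then show False
      using x(2) dz unfolding \<open>x = v\<close> by linarith
  qed
  moreover from this have "d v u = 0"
    using dz(1) d_self[OF V(2)] by simp
  ultimately show ?thesis
    using d_pos[OF V(3,1)] by fastforce
qed

text \<open>Used to show that the offset of a vertex inserted into one edge does not change when the
  viewpoint moves along another edge. The two exclusions are the two orientations of the same
  edge.\<close>

lemma (in tree_metric) arc_diff_eq:
  assumes "(u, z) \<in> parcs G" "(v, w) \<in> parcs G"
    and "\<not> (u = v \<and> z = w)" "\<not> (u = w \<and> z = v)"
  shows "d w u - d v u = d w z - d v z"
proof -
  have V: "u \<in> pverts G" "z \<in> pverts G"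
    using assms arc_in_verts by auto
  have "\<not> (d w u = d v u + 1 \<and> d w z = d v z - 1)"
    using arcs_aligned[OF assms(1,2)] assms(3) by blast
  moreover have "\<not> (d w z = d v z + 1 \<and> d w u = d v u - 1)"
    using arcs_aligned[OF arc_sym[OF assms(1)] assms(2)] assms(4) by blast
  ultimately show ?thesis
    using d_nbr_cases[OF assms(2) V(1)] d_nbr_cases[OF assms(2) V(2)] by arith
qed

primrec base :: "'a vertex \<Rightarrow> 'a vertex" where
  "base (Initial x) = Initial x"
| "base (Old v) = v"
| "base (Inserted v w) = v"
| "base (Leaf v i) = v"

text \<open>\<open>offset d x u\<close> is the distance from \<open>x\<close> to \<open>Old u\<close> minus that from \<open>Old (base x)\<close> to \<open>Old u\<close>.\<close>

primrec offset :: "('a vertex \<Rightarrow> 'a vertex \<Rightarrow> int) \<Rightarrow> 'a vertex \<Rightarrow> 'a vertex \<Rightarrow> int" where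
  "offset d (Initial x) u = 0"
| "offset d (Old v) u = 0"
| "offset d (Inserted v w) u = d w u - d v u"
| "offset d (Leaf v i) u = 1"

text \<open>Each old edge has become a path of length 3. An end that is an inserted vertex saves a
  step if it lies towards the other cluster and costs one otherwise; a leaf always costs
  one.\<close>

definition detour :: "('a vertex \<Rightarrow> 'a vertex \<Rightarrow> int) \<Rightarrow> 'a vertex \<Rightarrow> 'a vertex \<Rightarrow> int" where
  "detour d x y = 3 * d (base x) (base y) + offset d x (base y) + offset d y (base x)"

text \<open>The case \<open>x = y\<close> is separate because \<open>detour d x x\<close> is 2 for
  inserted vertices and leaves.\<close>

definition step_dist :: "('a vertex \<Rightarrow> 'a vertex \<Rightarrow> int) \<Rightarrow> 'a vertex \<Rightarrow> 'a vertex \<Rightarrow> int" where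
  "step_dist d x y = (if x = y then 0 else detour d x y)"

lemma pverts_step_cases:
  assumes "x \<in> pverts (algorithm_I_step G)"
  obtains v where "x = Old v" "v \<in> pverts G"
  | v w where "x = Inserted v w" "(v, w) \<in> parcs G"
  | v i where "x = Leaf v i" "v \<in> pverts G" "i < degree G v"
  using assms by (auto simp: algorithm_I_step_def)

locale vertex_tree_metric = tree_metric G d
  for G :: "'a vertex pair_pre_digraph" and d
begin

abbreviation G' where "G' \<equiv> algorithm_I_step G"

lemma base_in_verts: "x \<in> pverts G' \<Longrightarrow> base x \<in> pverts G"
  by (erule pverts_step_cases) (auto dest: arc_in_verts)

lemma offset_ge: "x \<in> pverts G' \<Longrightarrow> u \<in> pverts G \<Longrightarrow> - 1 \<le> offset d x u"
  by (erule pverts_step_cases) (auto dest: d_nbr_cases)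

lemma offset_base:
  "x \<in> pverts G' \<Longrightarrow> offset d x (base x) = (if x = Old (base x) then 0 else 1)"
  by (erule pverts_step_cases) (auto simp: d_self d_arc[OF arc_sym] dest: arc_in_verts)

lemma detour_sym:
  assumes "x \<in> pverts G'" "y \<in> pverts G'"
  shows "detour d x y = detour d y x"
  using d_sym base_in_verts assms by (simp add: detour_def)

lemma step_dist_Old:
  assumes "u \<in> pverts G"
  shows "step_dist d (Old u) y = 3 * d u (base y) + offset d y u"
  using assms by (auto simp: step_dist_def detour_def d_self)

lemma step_dist_pos:
  assumes "x \<in> pverts G'" "y \<in> pverts G'" "x \<noteq> y"
  shows "1 \<le> step_dist d x y"
proof (cases "base x = base y")
  case True
  then show ?thesis
    using offset_base[OF assms(1)] offset_base[OF assms(2)] assms d_self[OF base_in_verts]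
    by (auto simp: step_dist_def detour_def split: if_splits)
next
  \<comment> \<open>The worst case has both ends pointing at each other across one edge: 3 - 1 - 1 =
    1.\<close>
  case False
  then show ?thesis
    using assms d_pos[OF base_in_verts base_in_verts] offset_ge[OF _ base_in_verts, of x y]
      offset_ge[OF _ base_in_verts, of y x]
    by (fastforce simp: step_dist_def detour_def)
qed

lemma finite_verts_step: "finite (pverts G')"
proof -
  have "{Inserted v w | v w. (v, w) \<in> parcs G} = case_prod Inserted ` parcs G"
    "{Leaf v i | v i. v \<in> pverts G \<and> i < degree G v} =
      case_prod Leaf ` (SIGMA v:pverts G. {..<degree G v})"
    by (auto simp: image_iff)
  then show ?thesis
    using finite_verts finite_arcs by (simp add: algorithm_I_step_def)
qed

lemma arcs_step_Old:
  "(Old u, t) \<in> parcs G' \<longleftrightarrow>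
    (\<exists>z. t = Inserted u z \<and> (u, z) \<in> parcs G) \<or> (\<exists>i. t = Leaf u i \<and> u \<in> pverts G \<and> i < degree G u)"
  by (auto simp: algorithm_I_step_def)

lemma arcs_step_Inserted:
  "(Inserted u z, t) \<in> parcs G' \<longleftrightarrow> (u, z) \<in> parcs G \<and> (t = Old u \<or> t = Inserted z u)"
  by (auto simp: algorithm_I_step_def)

lemma arcs_step_Leaf:
  "(Leaf u i, t) \<in> parcs G' \<longleftrightarrow> t = Old u \<and> u \<in> pverts G \<and> i < degree G u"
  by (auto simp: algorithm_I_step_def)

lemma closer_step_Old:
  assumes u: "u \<in> pverts G" and y: "y \<in> pverts G'" "Old u \<noteq> y"
  shows "\<exists>s. (Old u, s) \<in> parcs G' \<and> step_dist d s y = step_dist d (Old u) y - 1 \<and>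
    (\<forall>t. (Old u, t) \<in> parcs G' \<longrightarrow> t \<noteq> s \<longrightarrow> step_dist d t y = step_dist d (Old u) y + 1)"
proof (cases "base y = u")
  case True
  have off: "offset d t u = 1" if "(Old u, t) \<in> parcs G'" for t
    using that u by (auto simp: arcs_step_Old d_self d_arc[OF arc_sym])
  have base: "base t = u" if "(Old u, t) \<in> parcs G'" for t
    using that by (auto simp: arcs_step_Old)
  \<comment> \<open>Every other vertex of the cluster of \<open>u\<close> is adjacent to
    \<open>Old u\<close>, so \<open>y\<close> itself is the closer neighbour.\<close>
  have arc: "(Old u, y) \<in> parcs G'"
    using y True by (auto simp: arcs_step_Old elim: pverts_step_cases)
  show ?thesis
  proof (intro exI conjI allI impI)
    show "(Old u, y) \<in> parcs G'" by fact
    show "step_dist d y y = step_dist d (Old u) y - 1"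
      using True u off[OF arc] by (simp add: step_dist_Old d_self) (simp add: step_dist_def)
    show "step_dist d t y = step_dist d (Old u) y + 1" if "(Old u, t) \<in> parcs G'" "t \<noteq> y" for t
      using that True u off[OF that(1)] off[OF arc] base[OF that(1)]
      by (simp add: step_dist_Old d_self) (simp add: step_dist_def detour_def d_self)
  qed
next
  case False
  have v: "base y \<in> pverts G" by (rule base_in_verts) fact
  obtain w where w: "(u, w) \<in> parcs G" "d w (base y) = d u (base y) - 1"
      "\<And>z. (u, z) \<in> parcs G \<Longrightarrow> z \<noteq> w \<Longrightarrow> d z (base y) = d u (base y) + 1"
    using closer[OF u v] False by metis
  show ?thesis
  proof (intro exI conjI allI impI)
    \<comment> \<open>The offset towards the cluster of \<open>y\<close> is -1 at this vertex and 1
      at every other neighbour of \<open>Old u\<close>.\<close>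
    show "(Old u, Inserted u w) \<in> parcs G'"
      using w by (simp add: arcs_step_Old)
    show "step_dist d (Inserted u w) y = step_dist d (Old u) y - 1"
      using False w(2) u by (auto simp: step_dist_Old) (auto simp: step_dist_def detour_def)
    show "step_dist d t y = step_dist d (Old u) y + 1"
      if "(Old u, t) \<in> parcs G'" "t \<noteq> Inserted u w" for t
    proof -
      from that(1) consider z where "t = Inserted u z" "(u, z) \<in> parcs G" | i where "t = Leaf u i"
        by (auto simp: arcs_step_Old)
      then show ?thesis
      proof cases
        case (1 z)
        then have "d z (base y) = d u (base y) + 1" "t \<noteq> y"
          using w(3) that(2) False by auto
        then show ?thesis
          unfolding step_dist_Old[OF u] using 1 by (simp add: step_dist_def detour_def)
      next
        case (2 i)
        then have "t \<noteq> y"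
          using False by auto
        then show ?thesis
          unfolding step_dist_Old[OF u] using 2 by (simp add: step_dist_def detour_def)
      qed
    qed
  qed
qed

lemma closer_step_Leaf:
  assumes u: "u \<in> pverts G" "i < degree G u" and y: "y \<in> pverts G'" "Leaf u i \<noteq> y"
  shows "\<exists>s. (Leaf u i, s) \<in> parcs G' \<and> step_dist d s y = step_dist d (Leaf u i) y - 1 \<and>
    (\<forall>t. (Leaf u i, t) \<in> parcs G' \<longrightarrow> t \<noteq> s \<longrightarrow> step_dist d t y = step_dist d (Leaf u i) y + 1)"
proof (intro exI conjI allI impI)
  show "(Leaf u i, Old u) \<in> parcs G'"
    using u by (simp add: arcs_step_Leaf)
  show "step_dist d (Old u) y = step_dist d (Leaf u i) y - 1"
    unfolding step_dist_Old[OF u(1)] using y(2) by (simp add: step_dist_def detour_def)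
qed (simp add: arcs_step_Leaf)

lemma closer_step_Inserted:
  assumes arc: "(u, z) \<in> parcs G" and y: "y \<in> pverts G'" "Inserted u z \<noteq> y"
  shows "\<exists>s. (Inserted u z, s) \<in> parcs G' \<and> step_dist d s y = step_dist d (Inserted u z) y - 1 \<and>
    (\<forall>t. (Inserted u z, t) \<in> parcs G' \<longrightarrow> t \<noteq> s \<longrightarrow>
      step_dist d t y = step_dist d (Inserted u z) y + 1)"
proof -
  have u: "u \<in> pverts G" and z: "z \<in> pverts G" and v: "base y \<in> pverts G"
    using arc arc_in_verts base_in_verts y by auto
  have Old: "step_dist d (Old u) y = 3 * d u (base y) + offset d y u"
    using u by (rule step_dist_Old)
  have x: "step_dist d (Inserted u z) y = 2 * d u (base y) + d z (base y) + offset d y u"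
    using y by (simp add: step_dist_def detour_def)
  show ?thesis
  \<comment> \<open>Here one of the two neighbours is the target itself, whose distance is not given
    by \<open>detour\<close>.\<close>
  proof (cases "y = Inserted z u")
    case True
    have "step_dist d (Inserted u z) y = 1" "step_dist d (Old u) y = 2" "step_dist d y y = 0"
      using True Old x d_arc[OF arc] d_arc[OF arc_sym[OF arc]] d_self[OF u] d_self[OF z]
      by (auto simp: step_dist_def)
    then show ?thesis
      using True arc by (intro exI[of _ y]) (auto simp: arcs_step_Inserted)
  next
    case False
    \<comment> \<open>For an inserted \<open>y\<close>, the exclusions in \<open>arc_diff_eq\<close>
      amount to \<open>y\<close> being neither \<open>Inserted u z\<close> nor
      \<open>Inserted z u\<close>.\<close>
    have off: "offset d y u = offset d y z"
      using y(1)
    proof (cases rule: pverts_step_cases)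
      case (2 v w)
      then show ?thesis
        using arc_diff_eq[OF arc, of v w] y False by auto
    qed auto
    have far: "step_dist d (Inserted z u) y = 2 * d z (base y) + d u (base y) + offset d y z"
      using False by (simp add: step_dist_def detour_def)
    from d_nbr_cases[OF arc v] show ?thesis
    proof
      assume "d z (base y) = d u (base y) + 1"
      then show ?thesis
        using Old x far off arc by (intro exI[of _ "Old u"]) (auto simp: arcs_step_Inserted)
    next
      assume "d z (base y) = d u (base y) - 1"
      then show ?thesis
        using Old x far off arc by (intro exI[of _ "Inserted z u"]) (auto simp: arcs_step_Inserted)
    qed
  qed
qed

lemma tree_metric_step: "tree_metric G' (step_dist d)"
proof
  show "finite (pverts G')"
    by (rule finite_verts_step)
  show "u \<in> pverts G' \<and> v \<in> pverts G'" if "(u, v) \<in> parcs G'" for u v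
    using that arc_in_verts arc_sym by (auto simp: algorithm_I_step_def)
  show "(v, u) \<in> parcs G'" if "(u, v) \<in> parcs G'" for u v
    using that arc_sym by (auto simp: algorithm_I_step_def)
  show "(u, u) \<notin> parcs G'" for u
    using arc_irrefl by (auto simp: algorithm_I_step_def)
  show "step_dist d u u = 0" for u
    by (simp add: step_dist_def)
  show "step_dist d u v = step_dist d v u" if "u \<in> pverts G'" "v \<in> pverts G'" for u v
    using detour_sym[OF that] by (simp add: step_dist_def)
  show "1 \<le> step_dist d u v" if "u \<in> pverts G'" "v \<in> pverts G'" "u \<noteq> v" for u v
    using that by (rule step_dist_pos)
  show "\<exists>w. (u, w) \<in> parcs G' \<and> step_dist d w v = step_dist d u v - 1 \<and>
      (\<forall>z. (u, z) \<in> parcs G' \<longrightarrow> z \<noteq> w \<longrightarrow> step_dist d z v = step_dist d u v + 1)"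
    if "u \<in> pverts G'" "v \<in> pverts G'" "u \<noteq> v" for u v
    using that(1)
  proof (cases rule: pverts_step_cases)
    case (1 x)
    then show ?thesis using closer_step_Old that by simp
  next
    case (2 x w)
    then show ?thesis using closer_step_Inserted that by simp
  next
    case (3 x i)
    then show ?thesis using closer_step_Leaf that by simp
  qed
qed

section \<open>Summation over clusters and the recursion for the distance sum\<close>

lemma sum_verts_step:
  fixes f :: "'a vertex \<Rightarrow> int"
  shows "sum f (pverts G') = (\<Sum>u\<in>pverts G.
    f (Old u) + (\<Sum>w\<in>nbrs u. f (Inserted u w)) + (\<Sum>i<degree G u. f (Leaf u i)))"
proof -
  let ?I = "case_prod Inserted ` (SIGMA v:pverts G. nbrs v)"
  let ?L = "case_prod Leaf ` (SIGMA v:pverts G. {..<degree G v})"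
  have "{Inserted v w | v w. (v, w) \<in> parcs G} = ?I"
    "{Leaf v i | v i. v \<in> pverts G \<and> i < degree G v} = ?L"
    using arc_in_verts by (auto simp: image_iff)
  then have "pverts G' = (Old ` pverts G \<union> ?I) \<union> ?L"
    by (simp add: algorithm_I_step_def)
  moreover have "finite ?I" "finite ?L" "finite (Old ` pverts G)"
    using finite_verts by auto
  moreover have "(Old ` pverts G \<union> ?I) \<inter> ?L = {}" "Old ` pverts G \<inter> ?I = {}"
    by auto
  ultimately have "sum f (pverts G') = sum f (Old ` pverts G) + sum f ?I + sum f ?L"
    by (simp only: sum.union_disjoint finite_UnI)
  also have "sum f (Old ` pverts G) = (\<Sum>u\<in>pverts G. f (Old u))"
    by (simp add: sum.reindex inj_on_def)
  also have "sum f ?I = (\<Sum>u\<in>pverts G. \<Sum>w\<in>nbrs u. f (Inserted u w))"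
    using finite_verts by (subst sum.reindex) (auto simp: inj_on_def sum.Sigma split_beta)
  also have "sum f ?L = (\<Sum>u\<in>pverts G. \<Sum>i<degree G u. f (Leaf u i))"
    using finite_verts by (subst sum.reindex) (auto simp: inj_on_def sum.Sigma split_beta)
  finally show ?thesis
    by (simp add: sum.distrib)
qed

text \<open>The weight is the cluster size: one old vertex, \<open>deg u\<close> inserted vertices
  and \<open>deg u\<close> leaves.\<close>

lemma sum_base:
  fixes f :: "'a vertex \<Rightarrow> int"
  shows "(\<Sum>x\<in>pverts G'. f (base x)) = (\<Sum>u\<in>pverts G. (1 + 2 * deg u) * f u)"
  unfolding sum_verts_step by (intro sum.cong) (auto simp: of_nat_degree algebra_simps deg_def[symmetric])

lemma card_verts_step:
  assumes "pverts G \<noteq> {}"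
  shows "int (card (pverts G')) - 1 = 5 * (int (card (pverts G)) - 1)"
  using sum_base[of "\<lambda>_. 1"] sum_deg[OF assms]
  by (simp add: sum.distrib sum_distrib_left[symmetric])

text \<open>In the cluster of \<open>u\<close>, the inserted vertices contribute
  \<open>deg u - 2\<close>, or \<open>deg u\<close> if \<open>u = v\<close>, and the leaves
  contribute \<open>deg u\<close>. The total does not depend on \<open>v\<close>.\<close>

lemma sum_offset:
  assumes v: "v \<in> pverts G"
  shows "(\<Sum>x\<in>pverts G'. offset d x v) = 2 * (int (card (pverts G)) - 1)"
proof -
  have "(\<Sum>x\<in>pverts G'. offset d x v) = (\<Sum>u\<in>pverts G. (\<Sum>w\<in>nbrs u. d w v) - deg u * d u v + deg u)"
    unfolding sum_verts_step by (simp add: sum_subtractf of_nat_degree deg_def[symmetric])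
  also have "\<dots> = (\<Sum>u\<in>pverts G. 2 * deg u - 2 + (if u = v then 2 else 0))"
    using v by (intro sum.cong) (auto simp: sum_nbrs_d)
  also have "\<dots> = 2 * (int (card (pverts G)) - 1)"
  proof -
    have "pverts G \<noteq> {}" using v by auto
    then show ?thesis
      using v finite_verts sum_deg by (simp add: sum.distrib sum_subtractf sum_distrib_left[symmetric])
  qed
  finally show ?thesis .
qed

lemma sum_detour_self: "(\<Sum>x\<in>pverts G'. detour d x x) = 4 * (\<Sum>u\<in>pverts G. deg u)"
proof -
  have "(\<Sum>x\<in>pverts G'. detour d x x) = (\<Sum>u\<in>pverts G. 4 * deg u)"
    unfolding sum_verts_step using sum_nbrs_self[of "\<lambda>x. 2 * x"]
    by (intro sum.cong refl) (simp add: detour_def d_self of_nat_degree)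
  then show ?thesis
    by (simp add: sum_distrib_left)
qed

lemma sum_step_dist:
  assumes "pverts G \<noteq> {}"
  shows "(\<Sum>x\<in>pverts G'. \<Sum>y\<in>pverts G'. step_dist d x y) =
    75 * (\<Sum>u\<in>pverts G. \<Sum>v\<in>pverts G. d u v)
      - 40 * (int (card (pverts G)) - 1)\<^sup>2 - 40 * (int (card (pverts G)) - 1)"
proof -
  define S where "S = (\<Sum>u\<in>pverts G. \<Sum>v\<in>pverts G. d u v)"
  define e where "e = int (card (pverts G)) - 1"
  define m where "m u = 1 + 2 * deg u" for u
  have n: "int (card (pverts G)) = e + 1"
    by (simp add: e_def)
  have deg: "(\<Sum>u\<in>pverts G. deg u) = 2 * e"
    using sum_deg[OF assms] by (simp add: e_def)
  have m: "(\<Sum>u\<in>pverts G. m u) = 5 * e + 1"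
    using deg n by (simp add: m_def sum.distrib sum_distrib_left[symmetric])
  have S': "(\<Sum>v\<in>pverts G. \<Sum>u\<in>pverts G. d u v) = S"
    unfolding S_def by (rule sum.swap)
  have md: "(\<Sum>u\<in>pverts G. m u * d u v) = 5 * (\<Sum>u\<in>pverts G. d u v) - 2 * e" if "v \<in> pverts G" for v
  proof -
    have "(\<Sum>u\<in>pverts G. m u * d u v) = (\<Sum>u\<in>pverts G. d u v) + 2 * (\<Sum>u\<in>pverts G. deg u * d u v)"
      by (simp add: m_def algebra_simps sum.distrib sum_distrib_left)
    then show ?thesis
      using sum_deg_d[OF that] by (simp add: e_def)
  qed
  \<comment> \<open>By symmetry of \<open>d\<close> and exchange of the sums, the weight moves into
    the inner sum, where \<open>sum_deg_d\<close> applies.\<close>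
  have degD: "(\<Sum>v\<in>pverts G. deg v * (\<Sum>u\<in>pverts G. d u v)) = 2 * S - (e + 1) * e"
  proof -
    have "(\<Sum>v\<in>pverts G. deg v * (\<Sum>u\<in>pverts G. d u v)) =
        (\<Sum>u\<in>pverts G. \<Sum>v\<in>pverts G. deg v * d v u)"
      unfolding sum_distrib_left by (subst sum.swap) (auto intro!: sum.cong simp: d_sym)
    also have "\<dots> = (\<Sum>u\<in>pverts G. 2 * (\<Sum>v\<in>pverts G. d v u) - e)"
      by (intro sum.cong) (auto simp: sum_deg_d e_def)
    also have "\<dots> = 2 * S - (e + 1) * e"
      using S' n by (simp add: sum_subtractf sum_distrib_left[symmetric])
    finally show ?thesis .
  qed
  have mmd: "(\<Sum>v\<in>pverts G. m v * (\<Sum>u\<in>pverts G. m u * d u v)) = 25 * S - 12 * (e + 1) * e - 8 * e\<^sup>2"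
  proof -
    have "(\<Sum>v\<in>pverts G. m v * (\<Sum>u\<in>pverts G. m u * d u v)) =
        (\<Sum>v\<in>pverts G. 5 * (\<Sum>u\<in>pverts G. d u v) + 10 * (deg v * (\<Sum>u\<in>pverts G. d u v)) - 2 * e * m v)"
      by (intro sum.cong refl) (simp add: md, simp add: m_def algebra_simps)
    also have "\<dots> = 5 * S + 10 * (2 * S - (e + 1) * e) - 2 * e * (5 * e + 1)"
      by (simp only: sum.distrib sum_subtractf sum_distrib_left[symmetric] S' degD m)
    finally show ?thesis
      by (simp add: algebra_simps power2_eq_square)
  qed
  have base: "(\<Sum>x\<in>pverts G'. \<Sum>y\<in>pverts G'. d (base x) (base y)) =
      (\<Sum>v\<in>pverts G. m v * (\<Sum>u\<in>pverts G. m u * d u v))"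
  proof -
    have "(\<Sum>x\<in>pverts G'. \<Sum>y\<in>pverts G'. d (base x) (base y)) =
        (\<Sum>x\<in>pverts G'. \<Sum>v\<in>pverts G. m v * d (base x) v)"
      unfolding m_def by (intro sum.cong refl sum_base)
    also have "\<dots> = (\<Sum>u\<in>pverts G. m u * (\<Sum>v\<in>pverts G. m v * d u v))"
      unfolding m_def by (rule sum_base)
    also have "\<dots> = (\<Sum>v\<in>pverts G. m v * (\<Sum>u\<in>pverts G. m u * d u v))"
      by (intro sum.cong refl) (simp add: d_sym)
    finally show ?thesis .
  qed
  have off: "(\<Sum>x\<in>pverts G'. \<Sum>y\<in>pverts G'. offset d x (base y)) = 2 * e * (5 * e + 1)"
  proof -
    have "(\<Sum>x\<in>pverts G'. \<Sum>y\<in>pverts G'. offset d x (base y)) =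
        (\<Sum>x\<in>pverts G'. \<Sum>v\<in>pverts G. m v * offset d x v)"
      unfolding m_def by (intro sum.cong refl sum_base)
    also have "\<dots> = (\<Sum>v\<in>pverts G. m v * (\<Sum>x\<in>pverts G'. offset d x v))"
      unfolding sum_distrib_left by (rule sum.swap)
    also have "\<dots> = (\<Sum>v\<in>pverts G. 2 * e * m v)"
      by (intro sum.cong) (auto simp: sum_offset e_def)
    finally show ?thesis
      by (simp add: sum_distrib_left[symmetric] m)
  qed
  have off': "(\<Sum>x\<in>pverts G'. \<Sum>y\<in>pverts G'. offset d y (base x)) = 2 * e * (5 * e + 1)"
    using off by (subst sum.swap)
  \<comment> \<open>\<open>detour\<close> splits into independently summable terms on the full
    square; the diagonal is then taken off.\<close>
  have "(\<Sum>y\<in>pverts G'. step_dist d x y) = (\<Sum>y\<in>pverts G'. detour d x y) - detour d x x"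
    if "x \<in> pverts G'" for x
  proof -
    have "(\<Sum>y\<in>pverts G'. step_dist d x y) =
        (\<Sum>y\<in>pverts G'. detour d x y - (if y = x then detour d x x else 0))"
      by (intro sum.cong) (auto simp: step_dist_def)
    then show ?thesis
      using that finite_verts_step by (simp add: sum_subtractf)
  qed
  then have "(\<Sum>x\<in>pverts G'. \<Sum>y\<in>pverts G'. step_dist d x y) =
      (\<Sum>x\<in>pverts G'. \<Sum>y\<in>pverts G'. detour d x y) - (\<Sum>x\<in>pverts G'. detour d x x)"
    by (simp add: sum_subtractf)
  also have "(\<Sum>x\<in>pverts G'. \<Sum>y\<in>pverts G'. detour d x y) =
      3 * (25 * S - 12 * (e + 1) * e - 8 * e\<^sup>2) + 2 * e * (5 * e + 1) + 2 * e * (5 * e + 1)"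
    unfolding detour_def sum.distrib sum_distrib_left[symmetric] base mmd off off' ..
  finally show ?thesis
    unfolding sum_detour_self deg by (simp add: S_def e_def algebra_simps power2_eq_square)
qed

end

section \<open>Hitting times of the simple random walk\<close>

text \<open>The reward \<open>g\<close> at time \<open>n\<close>, paid only if \<open>v\<close> has
  not been visited up to and including that time. With \<open>g = 1\<close> this is the indicator of
  a hitting time exceeding \<open>n\<close>.\<close>

definition killed :: "'a \<Rightarrow> nat \<Rightarrow> ('a \<Rightarrow> ennreal) \<Rightarrow> (nat \<Rightarrow> 'a) \<Rightarrow> ennreal" where
  "killed v n g \<omega> = (if \<forall>i\<le>n. \<omega> i \<noteq> v then g (\<omega> n) else 0)"

lemma measurable_killed:
  assumes "{..n} \<subseteq> J"
  shows "killed v n g \<in> borel_measurable (PiM J (\<lambda>_. count_space UNIV))"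
proof -
  have 1: "(\<lambda>\<omega>. \<omega> i) \<in> measurable (PiM J (\<lambda>_. count_space UNIV)) (count_space UNIV)" if "i \<le> n" for i
    using assms that by (intro measurable_component_singleton) auto
  have "(\<lambda>\<omega>. g (\<omega> n)) \<in> borel_measurable (PiM J (\<lambda>_. count_space UNIV))"
    using measurable_compose[OF 1[of n], of g borel] by simp
  moreover have "Measurable.pred (PiM J (\<lambda>_. count_space UNIV)) (\<lambda>\<omega>. \<forall>i\<in>{..n}. \<omega> i \<noteq> v)"
    using measurable_compose[OF 1, of _ "\<lambda>x. x \<noteq> v" "count_space UNIV"]
    by (intro pred_intros_finite) auto
  ultimately have "(\<lambda>\<omega>. if \<forall>i\<in>{..n}. \<omega> i \<noteq> v then g (\<omega> n) else 0)
      \<in> borel_measurable (PiM J (\<lambda>_. count_space UNIV))"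
    by (intro measurable_If) (auto simp: pred_def)
  then show ?thesis
    by (simp add: killed_def[abs_def] Ball_def)
qed

section \<open>Finite marginals of the trajectory law and the killed walk\<close>

context
  fixes G :: "'a pair_pre_digraph" and u :: 'a
begin

interpretation IT: Ionescu_Tulcea "srw_kernel G u" "\<lambda>_. count_space UNIV"
  by (rule Ionescu_Tulcea_srw_kernel)

lemma sets_srw: "sets (srw G u) = sets (PiM UNIV (\<lambda>_. count_space UNIV))"
  by (simp add: srw_def)

text \<open>The marginals of the projective limit on initial segments of time are the finite
  compositions of kernels.\<close>

lemma nn_integral_srw_restrict:
  assumes f: "f \<in> borel_measurable (PiM {0..<n} (\<lambda>_. count_space UNIV))"
  shows "(\<integral>\<^sup>+ \<omega>. f (restrict \<omega> {0..<n}) \<partial>srw G u) = (\<integral>\<^sup>+ \<omega>. f \<omega> \<partial>IT.C 0 n (\<lambda>_. undefined))"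
proof -
  let ?M = "\<lambda>_::nat. count_space (UNIV :: 'a set)"
  have up: "IT.up_to {0..<n} = n"
    using IT.up_to_iff_Ico[of "{0..<n}" n] IT.up_to[of "{0..<n}"] by (intro antisym) auto
  have "IT.CI {0..<n} = IT.C 0 n (\<lambda>_. undefined)"
    unfolding IT.CI_def up using IT.distr_C[of n n "\<lambda>_. undefined" 0] by (simp add: space_PiM)
  then have "distr (srw G u) (PiM {0..<n} ?M) (\<lambda>\<omega>. restrict \<omega> {0..<n}) = IT.C 0 n (\<lambda>_. undefined)"
    unfolding srw_def using IT.distr_lim[of "{0..<n}"] by simp
  moreover have "(\<lambda>\<omega>. restrict \<omega> {0..<n}) \<in> measurable (srw G u) (PiM {0..<n} ?M)"
    unfolding measurable_cong_sets[OF sets_srw refl] by (rule measurable_restrict_subset) simp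
  ultimately show ?thesis
    using nn_integral_distr[of "\<lambda>\<omega>. restrict \<omega> {0..<n}" "srw G u" "PiM {0..<n} ?M" f] f
    by (metis measurable_distr_eq1)
qed

lemma nn_integral_srw_killed:
  "(\<integral>\<^sup>+ \<omega>. killed v n g \<omega> \<partial>srw G u) = (\<integral>\<^sup>+ \<omega>. killed v n g \<omega> \<partial>IT.C 0 (Suc n) (\<lambda>_. undefined))"
proof -
  have "killed v n g \<omega> = killed v n g (restrict \<omega> {0..<Suc n})" for \<omega>
    by (auto simp: killed_def)
  then have "(\<integral>\<^sup>+ \<omega>. killed v n g \<omega> \<partial>srw G u) =
      (\<integral>\<^sup>+ \<omega>. killed v n g (restrict \<omega> {0..<Suc n}) \<partial>srw G u)"
    by (rule nn_integral_cong)
  also have "\<dots> = (\<integral>\<^sup>+ \<omega>. killed v n g \<omega> \<partial>IT.C 0 (Suc n) (\<lambda>_. undefined))"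
    by (intro nn_integral_srw_restrict measurable_killed) auto
  finally show ?thesis .
qed

lemma nn_integral_C_Suc:
  assumes "f \<in> borel_measurable (PiM {0..<Suc n} (\<lambda>_. count_space UNIV))"
  shows "(\<integral>\<^sup>+ \<omega>. f \<omega> \<partial>IT.C 0 (Suc n) (\<lambda>_. undefined)) =
    (\<integral>\<^sup>+ \<omega>. (\<integral>\<^sup>+ y. f (fun_upd \<omega> n y) \<partial>srw_kernel G u n \<omega>) \<partial>IT.C 0 n (\<lambda>_. undefined))"
proof -
  let ?M = "\<lambda>_::nat. count_space (UNIV :: 'a set)"
  have sp: "space (IT.C 0 n (\<lambda>_. undefined)) = space (PiM {0..<n} ?M)"
    by (subst IT.space_C) (auto simp: space_PiM)
  have st: "sets (IT.C 0 n (\<lambda>_. undefined)) = sets (PiM {0..<n} ?M)"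
    by (subst IT.sets_C) (auto simp: space_PiM)
  have "(\<integral>\<^sup>+ \<omega>. f \<omega> \<partial>IT.C 0 (Suc n) (\<lambda>_. undefined)) =
      (\<integral>\<^sup>+ \<omega>. (\<integral>\<^sup>+ x. f x \<partial>IT.eP n \<omega>) \<partial>IT.C 0 n (\<lambda>_. undefined))"
    using assms IT.measurable_eP[of n]
    by (simp add: measurable_cong_sets[OF st refl] nn_integral_bind[where B = "PiM {0..<Suc n} ?M"])
  also have "\<dots> = (\<integral>\<^sup>+ \<omega>. (\<integral>\<^sup>+ y. f (fun_upd \<omega> n y) \<partial>srw_kernel G u n \<omega>) \<partial>IT.C 0 n (\<lambda>_. undefined))"
    using assms by (intro nn_integral_cong IT.nn_integral_eP) (auto simp: sp)
  finally show ?thesis .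
qed

lemma nn_integral_killed_0:
  "(\<integral>\<^sup>+ \<omega>. killed v 0 g \<omega> \<partial>srw G u) = (if u = v then 0 else g u)"
proof -
  have "killed v 0 g \<in> borel_measurable (PiM {0..<Suc 0} (\<lambda>_. count_space UNIV))"
    by (rule measurable_killed) auto
  moreover have "(\<integral>\<^sup>+ y. killed v 0 g (fun_upd \<omega> 0 y) \<partial>srw_kernel G u 0 \<omega>) = (if u = v then 0 else g u)" for \<omega>
    by (auto simp: srw_kernel_def killed_def)
  moreover have "emeasure (IT.C 0 0 (\<lambda>_. undefined)) (space (IT.C 0 0 (\<lambda>_. undefined))) = 1"
    by (intro prob_space.emeasure_space_1 IT.prob_space_C) (simp add: space_PiM)
  ultimately show ?thesis
    unfolding nn_integral_srw_killed by (subst nn_integral_C_Suc) (simp_all del: IT.C.simps)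
qed

text \<open>The Markov property: integrating out the last position replaces \<open>g\<close> by its
  image under the transition operator killed at \<open>v\<close>.\<close>

lemma nn_integral_killed_Suc:
  "(\<integral>\<^sup>+ \<omega>. killed v (Suc n) g \<omega> \<partial>srw G u) =
   (\<integral>\<^sup>+ \<omega>. killed v n (\<lambda>x. \<integral>\<^sup>+ y. (if y = v then 0 else g y) \<partial>pmf_of_set {y. (x, y) \<in> parcs G}) \<omega> \<partial>srw G u)"
proof -
  have "(\<integral>\<^sup>+ y. killed v (Suc n) g (fun_upd \<omega> (Suc n) y) \<partial>srw_kernel G u (Suc n) \<omega>) =
      killed v n (\<lambda>x. \<integral>\<^sup>+ y. (if y = v then 0 else g y) \<partial>pmf_of_set {y. (x, y) \<in> parcs G}) \<omega>" for \<omega>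
  proof (cases "\<forall>i\<le>n. \<omega> i \<noteq> v")
    case True
    then have "killed v (Suc n) g (fun_upd \<omega> (Suc n) y) = (if y = v then 0 else g y)" for y
      by (auto simp: killed_def le_Suc_eq)
    then show ?thesis
      using True by (simp add: srw_kernel_def killed_def[of v n])
  next
    case False
    then have "killed v (Suc n) g (fun_upd \<omega> (Suc n) y) = 0" for y
      by (auto simp: killed_def le_Suc_eq)
    then show ?thesis
      using False by (auto simp: killed_def[of v n])
  qed
  moreover have "killed v (Suc n) g \<in> borel_measurable (PiM {0..<Suc (Suc n)} (\<lambda>_. count_space UNIV))"
    by (rule measurable_killed) auto
  ultimately show ?thesis
    unfolding nn_integral_srw_killed by (subst nn_integral_C_Suc) simp_all
qed


text \<open>The times before the first visit are counted one by one. Without a visit, both sides are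
  infinite, the left one as an infimum over the empty set.\<close>

lemma INF_eq_suminf_killed:
  "(INF n\<in>{n. \<omega> n = v}. of_nat n) = (\<Sum>n. killed v n (\<lambda>_. 1) \<omega>)"
proof (cases "\<exists>n. \<omega> n = v")
  case True
  define m where "m = (LEAST n. \<omega> n = v)"
  have m: "\<omega> m = v"
    unfolding m_def using True by (rule LeastI_ex)
  have least: "m \<le> n" if "\<omega> n = v" for n
    unfolding m_def using that by (rule Least_le)
  have "killed v n (\<lambda>_. 1) \<omega> = (if n \<in> {..<m} then 1 else 0)" for n
    using m least unfolding killed_def by (metis lessThan_iff linorder_not_le order_trans)
  then have "(\<Sum>n. killed v n (\<lambda>_. 1) \<omega>) = (\<Sum>n\<in>{..<m}. 1)"
    by (simp only:) (subst suminf_finite[of "{..<m}"], auto)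
  moreover have "(INF n\<in>{n. \<omega> n = v}. of_nat n) = (of_nat m :: ennreal)"
    using m least by (intro antisym INF_greatest INF_lower2[of m]) auto
  ultimately show ?thesis
    by simp
next
  case False
  then have "killed v n (\<lambda>_. 1) \<omega> = 1" for n
    by (simp add: killed_def)
  moreover have "(\<Sum>n::nat. 1 :: ennreal) = top"
    using ennreal_suminf_cmult[of _ "\<lambda>_. 1"] by (simp add: suminf_eq_SUP ennreal_SUP_of_nat_eq_top)
  ultimately show ?thesis
    using False by simp
qed

lemma measurable_killed_srw: "killed v n g \<in> borel_measurable (srw G u)"
  unfolding measurable_cong_sets[OF sets_srw refl] by (rule measurable_killed) simp

lemma hitting_time_eq_suminf:
  "hitting_time G u v = (\<Sum>n. \<integral>\<^sup>+ \<omega>. killed v n (\<lambda>_. 1) \<omega> \<partial>srw G u)"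
  unfolding hitting_time_def INF_eq_suminf_killed
  by (rule nn_integral_suminf) (rule measurable_killed_srw)

text \<open>A surviving walk stays in \<open>V\<close> and off \<open>v\<close>, so other values of
  \<open>g\<close> are never seen.\<close>

lemma nn_integral_killed_cong:
  assumes "u \<in> V"
    and V: "\<And>x y. x \<in> V \<Longrightarrow> x \<noteq> v \<Longrightarrow> y \<in> set_pmf (pmf_of_set {y. (x, y) \<in> parcs G}) \<Longrightarrow> y \<in> V"
    and "\<And>x. x \<in> V \<Longrightarrow> x \<noteq> v \<Longrightarrow> g x = g' x"
  shows "(\<integral>\<^sup>+ \<omega>. killed v n g \<omega> \<partial>srw G u) = (\<integral>\<^sup>+ \<omega>. killed v n g' \<omega> \<partial>srw G u)"
  using assms(3)
proof (induction n arbitrary: g g')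
  case 0
  then show ?case
    using assms(1) by (simp add: nn_integral_killed_0)
next
  case (Suc n)
  show ?case
    unfolding nn_integral_killed_Suc
  proof (rule Suc.IH)
    fix x assume "x \<in> V" "x \<noteq> v"
    then show "(\<integral>\<^sup>+ y. (if y = v then 0 else g y) \<partial>pmf_of_set {y. (x, y) \<in> parcs G}) =
        (\<integral>\<^sup>+ y. (if y = v then 0 else g' y) \<partial>pmf_of_set {y. (x, y) \<in> parcs G})"
      using V Suc.prems by (intro nn_integral_cong_AE) (auto simp: AE_measure_pmf_iff)
  qed
qed

text \<open>By \<open>step\<close> below, \<open>h u\<close> is the expected number of steps survived up to time \<open>n\<close> plus the
  expectation of \<open>h\<close> at time \<open>n\<close> on survival; the latter is at most \<open>C\<close> times a term of a convergent
  series.\<close>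

lemma hitting_time_eqI:
  fixes h :: "'a \<Rightarrow> ennreal"
  assumes u: "u \<in> V"
    and V: "\<And>x y. x \<in> V \<Longrightarrow> x \<noteq> v \<Longrightarrow> y \<in> set_pmf (pmf_of_set {y. (x, y) \<in> parcs G}) \<Longrightarrow> y \<in> V"
    and h_v: "h v = 0"
    and h_step: "\<And>x. x \<in> V \<Longrightarrow> x \<noteq> v \<Longrightarrow>
      h x = 1 + (\<integral>\<^sup>+ y. h y \<partial>pmf_of_set {y. (x, y) \<in> parcs G})"
    and h_bound: "\<And>x. x \<in> V \<Longrightarrow> h x \<le> C" and "C < top"
  shows "hitting_time G u v = h u"
proof -
  define A where "A n g = (\<integral>\<^sup>+ \<omega>. killed v n g \<omega> \<partial>srw G u)" for n and g :: "'a \<Rightarrow> ennreal"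
  have cong: "A n g = A n g'" if "\<And>x. x \<in> V \<Longrightarrow> x \<noteq> v \<Longrightarrow> g x = g' x" for n g g'
    unfolding A_def by (rule nn_integral_killed_cong[where V = V]) (use u V that in auto)
  have step: "A n h = A n (\<lambda>_. 1) + A (Suc n) h" for n
  proof -
    define K where "K x = (\<integral>\<^sup>+ y. h y \<partial>pmf_of_set {y. (x, y) \<in> parcs G})" for x
    have if_h: "(if y = v then 0 else h y) = h y" for y
      using h_v by simp
    have "A n h = A n (\<lambda>x. 1 + K x)"
      by (rule cong) (auto simp: h_step K_def)
    also have "\<dots> = A n (\<lambda>_. 1) + A n K"
      unfolding A_def
      by (subst nn_integral_add[symmetric])
        (auto simp: measurable_killed_srw killed_def intro!: nn_integral_cong)
    also have "A n K = A (Suc n) h"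
      unfolding A_def nn_integral_killed_Suc if_h K_def[abs_def] ..
    finally show ?thesis .
  qed
  have "A 0 h = h u"
    using h_v by (simp add: A_def nn_integral_killed_0)
  have partial: "h u = (\<Sum>i<n. A i (\<lambda>_. 1)) + A n h" for n
  proof (induction n)
    case 0
    then show ?case using \<open>A 0 h = h u\<close> by simp
  next
    case (Suc n)
    then show ?case using step[of n] by (simp add: add.assoc)
  qed
  have "(\<Sum>i. A i (\<lambda>_. 1)) \<le> h u"
  proof (rule suminf_le_const)
    show "(\<Sum>i<n. A i (\<lambda>_. 1)) \<le> h u" for n
      by (subst partial[of n]) (rule le_iff_add[THEN iffD2], blast)
  qed simp
  then have "(\<Sum>i. A i (\<lambda>_. 1)) < top"
    using h_bound[OF u] \<open>C < top\<close> by (meson le_less_trans)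
  \<comment> \<open>Survival probabilities are the terms of a convergent series; they are passed to
    the reals to conclude that they tend to 0.\<close>
  have tail: "(\<lambda>i. A i (\<lambda>_. 1)) \<longlonglongrightarrow> 0"
  proof -
    have fin: "A i (\<lambda>_. 1) < top" for i
      using \<open>(\<Sum>i. A i (\<lambda>_. 1)) < top\<close> ennreal_suminf_lessD by blast
    define r where "r i = enn2real (A i (\<lambda>_. 1))" for i
    have r: "A i (\<lambda>_. 1) = ennreal (r i)" for i
      unfolding r_def using fin by simp
    have "summable r"
      using \<open>(\<Sum>i. A i (\<lambda>_. 1)) < top\<close> unfolding r
      by (intro summable_suminf_not_top) (auto simp: r_def)
    then have "(\<lambda>i. ennreal (r i)) \<longlonglongrightarrow> ennreal 0"
      by (intro tendsto_ennrealI summable_LIMSEQ_zero)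
    then show ?thesis by (simp add: r)
  qed
  have "A n h \<le> C * A n (\<lambda>_. 1)" for n
  proof -
    \<comment> \<open>Truncation makes the bound by \<open>C\<close> hold everywhere and not only on
      \<open>V\<close>, as the pointwise comparison below requires.\<close>
    have "A n h = A n (\<lambda>x. min (h x) C)"
      using h_bound by (intro cong) (auto simp: min_absorb1)
    also have "\<dots> \<le> (\<integral>\<^sup>+ \<omega>. C * killed v n (\<lambda>_. 1) \<omega> \<partial>srw G u)"
      unfolding A_def by (intro nn_integral_mono) (auto simp: killed_def)
    also have "\<dots> = C * A n (\<lambda>_. 1)"
      unfolding A_def by (rule nn_integral_cmult) (rule measurable_killed_srw)
    finally show ?thesis .
  qed
  moreover have "(\<lambda>n. C * A n (\<lambda>_. 1)) \<longlonglongrightarrow> C * 0"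
    using \<open>C < top\<close> tail by (intro ennreal_tendsto_cmult) auto
  ultimately have "(\<lambda>n. A n h) \<longlonglongrightarrow> 0"
    by (intro tendsto_sandwich[of "\<lambda>_. 0" "\<lambda>n. A n h" sequentially "\<lambda>n. C * A n (\<lambda>_. 1)"]) auto
  then have "(\<lambda>n. (\<Sum>i<n. A i (\<lambda>_. 1)) + A n h) \<longlonglongrightarrow> (\<Sum>i. A i (\<lambda>_. 1)) + 0"
    by (intro tendsto_add summable_LIMSEQ) auto
  then have "(\<lambda>_. h u) \<longlonglongrightarrow> (\<Sum>i. A i (\<lambda>_. 1))"
    unfolding partial[symmetric] by simp
  then have "h u = (\<Sum>i. A i (\<lambda>_. 1))"
    by (simp only: LIMSEQ_const_iff)
  then show ?thesis
    by (simp add: hitting_time_eq_suminf A_def)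
qed

end

section \<open>Hitting times and their mean on a tree\<close>

context tree_metric
begin

lemma hitting_time_eq:
  assumes "u \<in> pverts G" "v \<in> pverts G"
  shows "hitting_time G u v = ennreal (real_of_int (twice_hitting u v) / 2)"
proof (rule hitting_time_eqI[where V = "pverts G"])
  have nb: "{y. (x, y) \<in> parcs G} = nbrs x" for x
    by (simp add: nbrs_def)
  \<comment> \<open>\<open>pmf_of_set\<close> is the uniform distribution only on a nonempty finite
    set.\<close>
  have ne: "nbrs x \<noteq> {}" if "x \<in> pverts G" "x \<noteq> v" for x
    using closer[OF that(1) assms(2) that(2)] by auto
  show "y \<in> pverts G" if "x \<in> pverts G" "x \<noteq> v" "y \<in> set_pmf (pmf_of_set {y. (x, y) \<in> parcs G})" for x y
    using that ne[OF that(1,2)] unfolding nb by (auto dest: arc_in_verts)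
  show "ennreal (real_of_int (twice_hitting v v) / 2) = 0"
    by (simp add: twice_hitting_self assms)
  show "ennreal (real_of_int (twice_hitting x v) / 2) =
      1 + (\<integral>\<^sup>+ y. ennreal (real_of_int (twice_hitting y v) / 2) \<partial>pmf_of_set {y. (x, y) \<in> parcs G})"
    if x: "x \<in> pverts G" "x \<noteq> v" for x
  proof -
    have nonneg: "0 \<le> twice_hitting y v" if "y \<in> nbrs x" for y
      using twice_hitting_nonneg that arc_in_verts assms by auto
    have deg: "real (card (nbrs x)) = real_of_int (deg x)" "deg x > 0"
      using ne[OF x] by (auto simp: deg_def card_gt_0_iff)
    have "(\<integral>\<^sup>+ y. ennreal (real_of_int (twice_hitting y v) / 2) \<partial>pmf_of_set (nbrs x)) =
        (\<Sum>y\<in>nbrs x. ennreal (real_of_int (twice_hitting y v) / 2)) / real (card (nbrs x))"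
      using nn_integral_pmf_of_set[OF ne[OF x]] by (simp add: ennreal_of_nat_eq_real_of_nat)
    also have "(\<Sum>y\<in>nbrs x. ennreal (real_of_int (twice_hitting y v) / 2)) =
        ennreal (\<Sum>y\<in>nbrs x. real_of_int (twice_hitting y v) / 2)"
      using nonneg by (intro sum_ennreal) auto
    also have "(\<Sum>y\<in>nbrs x. real_of_int (twice_hitting y v) / 2) = real_of_int (deg x) * (real_of_int (twice_hitting x v) - 2) / 2"
      using arg_cong[OF sum_nbrs_twice_hitting[OF x(1) assms(2) x(2)], of real_of_int]
      by (simp add: sum_divide_distrib[symmetric])
    also have "ennreal \<dots> / real (card (nbrs x)) = ennreal (real_of_int (twice_hitting x v) / 2 - 1)"
    proof -
      have "0 \<le> deg x * (twice_hitting x v - 2)"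
        unfolding sum_nbrs_twice_hitting[OF x(1) assms(2) x(2), symmetric] using nonneg by (intro sum_nonneg) auto
      then have "0 \<le> real_of_int (deg x) * (real_of_int (twice_hitting x v) - 2)"
        by (metis of_int_0_le_iff of_int_diff of_int_mult of_int_numeral)
      then show ?thesis
        unfolding deg(1) using deg(2) by (subst divide_ennreal) (auto simp: field_simps)
    qed
    finally have I: "(\<integral>\<^sup>+ y. ennreal (real_of_int (twice_hitting y v) / 2) \<partial>pmf_of_set (nbrs x)) =
        ennreal (real_of_int (twice_hitting x v) / 2 - 1)" .
    \<comment> \<open>\<open>ennreal\<close> maps negative reals to 0, so adding 1 to the shifted
      value restores it only under this bound.\<close>
    have "2 \<le> twice_hitting x v"
    proof -
      have "0 \<le> deg x * (twice_hitting x v - 2)"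
        unfolding sum_nbrs_twice_hitting[OF x(1) assms(2) x(2), symmetric] using nonneg by (intro sum_nonneg) auto
      then show ?thesis using deg(2) by (simp add: zero_le_mult_iff)
    qed
    then show ?thesis
      unfolding nb I by (subst ennreal_1[symmetric], subst ennreal_plus[symmetric]) auto
  qed
  \<comment> \<open>A finite sum of nonnegative values serves as the uniform bound
    \<open>C\<close>.\<close>
  show "ennreal (real_of_int (twice_hitting x v) / 2) \<le>
      (\<Sum>x\<in>pverts G. ennreal (real_of_int (twice_hitting x v) / 2))" if "x \<in> pverts G" for x
    using that finite_verts by (intro member_le_sum) auto
  show "(\<Sum>x\<in>pverts G. ennreal (real_of_int (twice_hitting x v) / 2)) < top"
    using assms by (subst sum_ennreal) (auto simp: twice_hitting_nonneg)
qed (use assms in auto)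

text \<open>The factor \<open>n - 1\<close>, which is the number of edges in the hitting-time sum,
  cancels against the normalisation and is nonzero because \<open>n\<close> is at least 2.\<close>

lemma mean_hitting_time_eq:
  assumes "2 \<le> card (pverts G)"
  shows "mean_hitting_time G =
    ennreal (real_of_int (\<Sum>u\<in>pverts G. \<Sum>v\<in>pverts G. d u v) / real (card (pverts G)))"
proof -
  define S where "S = (\<Sum>u\<in>pverts G. \<Sum>v\<in>pverts G. d u v)"
  define n where "n = card (pverts G)"
  have ne: "pverts G \<noteq> {}" using assms by auto
  have "(\<Sum>u\<in>pverts G. \<Sum>v\<in>pverts G. hitting_time G u v) =
      ennreal (\<Sum>u\<in>pverts G. \<Sum>v\<in>pverts G. real_of_int (twice_hitting u v) / 2)"
    by (simp add: hitting_time_eq twice_hitting_nonneg sum_nonneg sum_ennreal)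
  also have "(\<Sum>u\<in>pverts G. \<Sum>v\<in>pverts G. real_of_int (twice_hitting u v) / 2) = real (n - 1) * real_of_int S"
    using arg_cong[OF sum_twice_hitting[OF ne], of real_of_int] assms
    by (simp add: sum_divide_distrib[symmetric] S_def n_def of_nat_diff)
  finally have "mean_hitting_time G = ennreal (real (n - 1) * real_of_int S) / ennreal (real (n * (n - 1)))"
    by (simp add: mean_hitting_time_def n_def ennreal_of_nat_eq_real_of_nat del: of_nat_mult)
  also have "\<dots> = ennreal (real (n - 1) * real_of_int S / real (n * (n - 1)))"
    using assms by (intro divide_ennreal mult_nonneg_nonneg) (auto simp: S_def n_def d_nonneg sum_nonneg)
  also have "real (n - 1) * real_of_int S / real (n * (n - 1)) = real_of_int S / real n"
    using assms by (auto simp: n_def)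
  finally show ?thesis
    by (simp add: S_def n_def)
qed

end

section \<open>The mean hitting time of the tree sequence\<close>

lemma tree_metric_initial:
  assumes "tree_metric G d"
  shows "tree_metric (algorithm_I G 0) (\<lambda>x y. d (inv Initial x) (inv Initial y))"
proof -
  interpret tree_metric G d by fact
  have inv [simp]: "inv Initial (Initial x) = x" for x :: 'a
    by (rule inv_f_f) (simp add: inj_def)
  have arc: "(Initial u, y) \<in> parcs (algorithm_I G 0) \<longleftrightarrow> (\<exists>w. y = Initial w \<and> (u, w) \<in> parcs G)" for u y
    by force
  show ?thesis
  proof
    show "\<exists>w. (x, w) \<in> parcs (algorithm_I G 0) \<and>
        d (inv Initial w) (inv Initial y) = d (inv Initial x) (inv Initial y) - 1 \<and>
        (\<forall>z. (x, z) \<in> parcs (algorithm_I G 0) \<longrightarrow> z \<noteq> w \<longrightarrow>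
          d (inv Initial z) (inv Initial y) = d (inv Initial x) (inv Initial y) + 1)"
      if xy: "x \<in> pverts (algorithm_I G 0)" "y \<in> pverts (algorithm_I G 0)" "x \<noteq> y" for x y
    proof -
      obtain u v where uv: "x = Initial u" "y = Initial v" "u \<in> pverts G" "v \<in> pverts G" "u \<noteq> v"
        using xy by auto
      from closer[OF uv(3-5)] show ?thesis
        unfolding uv(1,2) arc by force
    qed
    show "1 \<le> d (inv Initial x) (inv Initial y)"
      if "x \<in> pverts (algorithm_I G 0)" "y \<in> pverts (algorithm_I G 0)" "x \<noteq> y" for x y
      using that by (auto intro!: d_pos)
  qed (use finite_verts arc_in_verts arc_sym arc_irrefl d_self d_sym in auto)
qed

text \<open>The closed form solves
  \<open>W' = 75 * W - 20 * (5 ^ t * e)\<^sup>2 - 20 * 5 ^ t * e\<close>. The forcing terms grow by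
  factors 25 and 5, so they are divided by 75 - 25 = 50 and 75 - 5 = 70; hence the denominators 10
  and 14 after extracting \<open>4 * 5 ^ t\<close>.\<close>

lemma tree_metric_algorithm_I:
  assumes "undirected_tree G"
  shows "\<exists>d. tree_metric (algorithm_I G t) d \<and> pverts (algorithm_I G t) \<noteq> {} \<and>
    real (card (pverts (algorithm_I G t))) = 5 ^ t * (real (card (pverts G)) - 1) + 1 \<and>
    real_of_int (\<Sum>u\<in>pverts (algorithm_I G t). \<Sum>v\<in>pverts (algorithm_I G t). d u v) =
      2 * (75 ^ t * wiener_index G
        - 4 * 5 ^ t * ((15 ^ t - 5 ^ t) / 10 * (real (card (pverts G)) - 1)\<^sup>2
                       + (15 ^ t - 1) / 14 * (real (card (pverts G)) - 1)))"
proof (induction t)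
  case 0
  obtain d where d: "tree_metric G d"
    and dist: "\<And>u v. u \<in> pverts G \<Longrightarrow> v \<in> pverts G \<Longrightarrow> graph_dist G u v = real_of_int (d u v)"
    using undirected_tree_imp_tree_metric[OF assms] by metis
  have inj: "inj_on Initial (pverts G)"
    by (simp add: inj_on_def)
  have inv [simp]: "inv Initial (Initial x) = x" for x :: 'a
    by (rule inv_f_f) (simp add: inj_def)
  have "pverts G \<noteq> {}"
    using assms by (auto simp: undirected_tree_def connected_conv)
  moreover have "2 * wiener_index G = (\<Sum>u\<in>pverts G. \<Sum>v\<in>pverts G. real_of_int (d u v))"
    unfolding wiener_index_def by (simp add: dist)
  ultimately show ?case
    using tree_metric_initial[OF d] inj
    by (intro exI[of _ "\<lambda>x y. d (inv Initial x) (inv Initial y)"]) (simp add: sum.reindex card_image)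
next
  case (Suc t)
  define e where "e = real (card (pverts G)) - 1"
  define H where "H = algorithm_I G t"
  from Suc obtain d where "tree_metric H d" and ne: "pverts H \<noteq> {}"
    and card: "real (card (pverts H)) = 5 ^ t * e + 1"
    and sum: "real_of_int (\<Sum>u\<in>pverts H. \<Sum>v\<in>pverts H. d u v) =
      2 * (75 ^ t * wiener_index G
        - 4 * 5 ^ t * ((15 ^ t - 5 ^ t) / 10 * e\<^sup>2 + (15 ^ t - 1) / 14 * e))"
    unfolding e_def H_def by blast
  then interpret vertex_tree_metric H d
    by (simp add: vertex_tree_metric_def)
  have "real_of_int (int (card (pverts G')) - 1) = real_of_int (5 * (int (card (pverts H)) - 1))"
    by (simp only: card_verts_step[OF ne])
  then have "real (card (pverts G')) = 5 ^ Suc t * e + 1"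
    using card by simp
  moreover have "real_of_int (\<Sum>u\<in>pverts G'. \<Sum>v\<in>pverts G'. step_dist d u v) =
      2 * (75 ^ Suc t * wiener_index G
        - 4 * 5 ^ Suc t * ((15 ^ Suc t - 5 ^ Suc t) / 10 * e\<^sup>2 + (15 ^ Suc t - 1) / 14 * e))"
  proof -
    have "real_of_int (\<Sum>u\<in>pverts G'. \<Sum>v\<in>pverts G'. step_dist d u v) =
        75 * real_of_int (\<Sum>u\<in>pverts H. \<Sum>v\<in>pverts H. d u v) - 40 * (5 ^ t * e)\<^sup>2 - 40 * (5 ^ t * e)"
      unfolding sum_step_dist[OF ne] using card by simp
    then show ?thesis
      unfolding sum by (simp add: field_simps power2_eq_square)
  qed
  moreover have "pverts G' \<noteq> {}"
    using ne by (auto simp: algorithm_I_step_def)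
  ultimately show ?case
    using tree_metric_step unfolding e_def H_def by auto
qed

theorem theorem5:
  fixes T\<^sub>0 :: "'a pair_pre_digraph" and t :: nat
  assumes "undirected_tree T\<^sub>0"
    and "card (pverts T\<^sub>0) \<ge> 2"
  shows "mean_hitting_time (algorithm_I T\<^sub>0 t) =
    ennreal (2 / (5 ^ t * (real (card (pverts T\<^sub>0)) - 1) + 1) *
      (75 ^ t * wiener_index T\<^sub>0
        - 4 * 5 ^ t * ((15 ^ t - 5 ^ t) / 10 * (real (card (pverts T\<^sub>0)) - 1)\<^sup>2
                       + (15 ^ t - 1) / 14 * (real (card (pverts T\<^sub>0)) - 1))))"
proof -
  define H where "H = algorithm_I T\<^sub>0 t"
  define n where "n = real (card (pverts T\<^sub>0)) - 1"
  obtain d where "tree_metric H d"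
    and card: "real (card (pverts H)) = 5 ^ t * n + 1"
    and sum: "real_of_int (\<Sum>u\<in>pverts H. \<Sum>v\<in>pverts H. d u v) =
      2 * (75 ^ t * wiener_index T\<^sub>0
        - 4 * 5 ^ t * ((15 ^ t - 5 ^ t) / 10 * n\<^sup>2 + (15 ^ t - 1) / 14 * n))"
    using tree_metric_algorithm_I[OF assms(1), of t] unfolding H_def n_def by blast
  then interpret tree_metric H d
    by simp
  have "1 \<le> n"
    using assms(2) by (simp add: n_def)
  moreover have "(1 :: real) \<le> 5 ^ t"
    by simp
  ultimately have "1 * 1 \<le> 5 ^ t * n"
    by (intro mult_mono) auto
  then have "2 \<le> card (pverts H)"
    using card by linarith
  show ?thesis
    unfolding H_def[symmetric] n_def[symmetric] mean_hitting_time_eq[OF \<open>2 \<le> card (pverts H)\<close>] sum card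
    by (simp only: times_divide_eq_left)
qed

end
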